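(* Let $0<q<1$, let $N\ge1$ be an integer and let $\gamma,\delta$ be real with either $0<\gamma q<1$, $0<\delta q<1$, or $\gamma>q^{-N}$, $\delta>q^{-N}$. Let $a,b,\beta\in\mathbb R$ be defined by $$b-a=N+1\ (\text{so } q^{a-b}=q^{-N-1}),\qquad q^\beta=\gamma,\qquad q^{2a}=\gamma\delta,$$ and put $$\widetilde\mu(s)=q^{a+1}\frac{\mu(s+a)-c_3}{c_1},\qquad C_n=(\gamma\delta q)^{n/2}\kappa_q^{2n},\qquad x(s)=q^{-s}+\gamma\delta q^{s+1}$$ (so that $\widetilde\mu(s)=x(s)$). Then for all $0\le n\le N$ and $s=0,1,\dots,N$, $$\lim_{q^\alpha\to0}C_n\,u_n^{\alpha,\beta}(\mu(s+a),a,b)_q=R_n(x(s),\gamma,\delta,N;q),$$ the limit being over real $\alpha\to+\infty$, where $R_n$ are the monic dual $q$-Hahn polynomials. Moreover, the orthogonality relation of the non-standard $q$-Racah polynomials $$\sum_{s=0}^{N}u_n^{\alpha,\beta}(s+a)_q\,u_m^{\alpha,\beta}(s+a)_q\,\rho(s+a)\,[2s+2a+1]_q=\delta_{n,m}d_n^2,$$ multiplied by $C_nC_m$, becomes in the limit $q^\alpha\to0$ the orthogonality relation of the dual $q$-Hahn polynomials $$\sum_{s=0}^NR_n(s)_qR_m(s)_q\,\widetilde\rho(s)\,\Delta x(s-\tfrac12)=\widetilde d_n^{\,2}\,\delta_{n,m};$$ that is, $\rho(s+a)[2s+2a+1]_q\to\widetilde\rho(s)\,\Delta x(s-\tfrac12)$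 for $s=0,\dots,N$ and $C_n^2d_n^2\to\widetilde d_n^{\,2}$ for $0\le n\le N$.
   Context: Notation. $0<q<1$, $q^z=e^{z\log q}$. $(x;q)_k=\prod_{i=0}^{k-1}(1-xq^i)$, $(x;q)_\infty=\prod_{i\ge0}(1-xq^i)$, $(x_1,\dots,x_r;q)_k=\prod_j(x_j;q)_k$; ${}_r\varphi_{r-1}$ is the standard basic hypergeometric series. $\kappa_q=q^{1/2}-q^{-1/2}$; $[s]_q=\dfrac{q^{s/2}-q^{-s/2}}{q^{1/2}-q^{-1/2}}$. $\Delta f(s)=f(s+1)-f(s)$. Lattice: $\mu(s)=[s]_q[s+1]_q=c_1(q^s+q^{-s-1})+c_3$ with $c_1=q^{1/2}\kappa_q^{-2}$, $c_3=-q^{-1/2}(1+q)\kappa_q^{-2}$. Non-standard monic $q$-Racah polynomials ($0\le n\le b-a-1$): $$u_n^{\alpha,\beta}(s)_q=u_n^{\alpha,\beta}(\mu(s),a,b)_q=q^{-\frac n2(2a+1)}\frac{(q^{a-b+1},q^{\beta+1},q^{a+b+\alpha+1};q)_n}{\kappa_q^{2n}(q^{\alpha+\beta+n+1};q)_n}\;{}_4\varphi_3\!\left(\begin{matrix}q^{-n},q^{\alpha+\beta+n+1},q^{a-s},q^{a+s+1}\\ q^{a-b+1},q^{\beta+1},q^{a+b+\alpha+1}\end{matrix}\Big|\,q,q\right).$$ Squared norms: $$d_n^2=\frac{(q,q^{\alpha+1},q^{\beta+1},q^{b-a+\alpha+\beta+1},q^{a+b+\alpha+1},q^{a-b+1},q^{\beta-a-b+1};q)_n}{\kappa_q^{4n}(q^{\alpha+\beta+2};q)_{2n}(q^{\alpha+\beta+n+1};q)_n}.$$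 Weight: $$\rho(s)=\frac{\widetilde\Gamma_q(s+a+1)\widetilde\Gamma_q(s-a+\beta+1)\widetilde\Gamma_q(s+\alpha+b+1)\widetilde\Gamma_q(b+\alpha-s)\widetilde\Gamma_q(\alpha+\beta+2)\widetilde\Gamma_q(b-a)\widetilde\Gamma_q(a+b-\beta)}{\widetilde\Gamma_q(s-a+1)\widetilde\Gamma_q(s+b+1)\widetilde\Gamma_q(s+a-\beta+1)\widetilde\Gamma_q(b-s)\widetilde\Gamma_q(\alpha+1)\widetilde\Gamma_q(\beta+1)\widetilde\Gamma_q(b-a+\alpha+\beta+1)\widetilde\Gamma_q(a+b+\alpha+1)},$$ where $\widetilde\Gamma_q(s)=q^{-\frac{(s-1)(s-2)}4}(1-q)^{1-s}\dfrac{(q;q)_\infty}{(q^s;q)_\infty}$, so that $\widetilde\Gamma_q(s+1)=[s]_q\widetilde\Gamma_q(s)$. Quotients of $\widetilde\Gamma_q$-values whose arguments differ by integers are understood through this functional equation (removable singularities removed). Monic dual $q$-Hahn polynomials: $$R_n(s)_q=R_n(x(s),\gamma,\delta,N;q)=(\gamma q,q^{-N};q)_n\;{}_3\varphi_2\!\left(\begin{matrix}q^{-n},q^{-s},\gamma\delta q^{s+1}\\ \gamma q,q^{-N}\end{matrix}\Big|\,q,q\right),\qquad x(s)=q^{-s}+\gamma\delta q^{s+1},$$ with $\Delta x(s-\frac12)=x(s+\frac12)-x(s-\frac12)=(-\kappa_q)q^{-s}(1-\gamma\delta q^{2s+1})$, $$\widetilde\rho(s)=\frac{(\gamma q)^N(\delta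 q;q)_N}{(\gamma\delta q^2;q)_N}\cdot\frac{q^{Ns-\binom s2}}{(-\kappa_q)(1-\gamma\delta q)(-\gamma)^s}\cdot\frac{(\gamma q,\gamma\delta q,q^{-N};q)_s}{(q,\gamma\delta q^{N+2},\delta q;q)_s},\qquad \widetilde d_n^{\,2}=(\gamma\delta q)^n(q,q^{-N},\gamma q,\delta^{-1}q^{-N};q)_n,$$ where, if $\gamma\delta q=1$, common factors in $\widetilde\rho(s)\Delta x(s-\frac12)$ are cancelled. *)

theory Defs
  imports "HOL-Analysis.Analysis"
begin

definition qpoch :: "real \<Rightarrow> real \<Rightarrow> nat \<Rightarrow> real" where
  "qpoch x q k = (\<Prod>i<k. 1 - x * q ^ i)"

definition qpoch_inf :: "real \<Rightarrow> real \<Rightarrow> real" where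
  "qpoch_inf x q = prodinf (\<lambda>i. 1 - x * q ^ i)"

definition qpochs :: "real list \<Rightarrow> real \<Rightarrow> nat \<Rightarrow> real" where
  "qpochs xs q k = prod_list (map (\<lambda>x. qpoch x q k) xs)"

text \<open>
  The basic hypergeometric series with one more upper than lower parameter. It is only used with
  an upper parameter \<open>q powr - real n\<close>, so all terms with index above \<open>n\<close> have numerator \<open>0\<close>.
  They vanish also where a lower parameter \<open>q powr - real N\<close> with \<open>n \<le> N\<close> makes the
  denominator \<open>0\<close>, which is the usual convention for the terminating series.
\<close>
definition qhyp :: "real list \<Rightarrow> real list \<Rightarrow> real \<Rightarrow> real \<Rightarrow> real" where
  "qhyp as bs q z = (\<Sum>k. qpochs as q k / (qpochs bs q k * qpoch q q k) * z ^ k)"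

definition kappa :: "real \<Rightarrow> real" where
  "kappa q = q powr (1/2) - q powr (- (1/2))"

definition qnum :: "real \<Rightarrow> real \<Rightarrow> real" where
  "qnum q s = (q powr (s/2) - q powr (- (s/2))) / (q powr (1/2) - q powr (- (1/2)))"

definition fdiff :: "(real \<Rightarrow> real) \<Rightarrow> real \<Rightarrow> real" where
  "fdiff f s = f (s + 1) - f s"

definition lattice_mu :: "real \<Rightarrow> real \<Rightarrow> real" where
  "lattice_mu q s = qnum q s * qnum q (s + 1)"

definition lattice_c1 :: "real \<Rightarrow> real" where
  "lattice_c1 q = q powr (1/2) / (kappa q)\<^sup>2"

definition lattice_c3 :: "real \<Rightarrow> real" where
  "lattice_c3 q = - (q powr (- (1/2)) * (1 + q) / (kappa q)\<^sup>2)"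

text \<open>The non-standard monic q-Racah polynomial at the lattice point \<open>\<mu>(s)\<close>, as a function of \<open>s\<close>.\<close>
definition qracah :: "real \<Rightarrow> real \<Rightarrow> real \<Rightarrow> real \<Rightarrow> real \<Rightarrow> nat \<Rightarrow> real \<Rightarrow> real" where
  "qracah q \<alpha> \<beta> a b n s =
     q powr (- (real n / 2) * (2 * a + 1))
     * (qpochs [q powr (a - b + 1), q powr (\<beta> + 1), q powr (a + b + \<alpha> + 1)] q n
        / (kappa q ^ (2 * n) * qpoch (q powr (\<alpha> + \<beta> + real n + 1)) q n))
     * qhyp [q powr (- real n), q powr (\<alpha> + \<beta> + real n + 1), q powr (a - s), q powr (a + s + 1)]
            [q powr (a - b + 1), q powr (\<beta> + 1), q powr (a + b + \<alpha> + 1)] q q"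

text \<open>The squared norm \<open>d\<^sub>n\<^sup>2\<close>.\<close>
definition qracah_norm2 :: "real \<Rightarrow> real \<Rightarrow> real \<Rightarrow> real \<Rightarrow> real \<Rightarrow> nat \<Rightarrow> real" where
  "qracah_norm2 q \<alpha> \<beta> a b n =
     qpochs [q, q powr (\<alpha> + 1), q powr (\<beta> + 1), q powr (b - a + \<alpha> + \<beta> + 1),
             q powr (a + b + \<alpha> + 1), q powr (a - b + 1), q powr (\<beta> - a - b + 1)] q n
     / (kappa q ^ (4 * n) * qpoch (q powr (\<alpha> + \<beta> + 2)) q (2 * n)
        * qpoch (q powr (\<alpha> + \<beta> + real n + 1)) q n)"

definition tGamma :: "real \<Rightarrow> real \<Rightarrow> real" where
  "tGamma q s =
     q powr (- ((s - 1) * (s - 2) / 4)) * (1 - q) powr (1 - s) * (qpoch_inf q q / qpoch_inf (q powr s) q)"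

definition qracah_rho :: "real \<Rightarrow> real \<Rightarrow> real \<Rightarrow> real \<Rightarrow> real \<Rightarrow> real \<Rightarrow> real" where
  "qracah_rho q \<alpha> \<beta> a b s =
     (tGamma q (s + a + 1) * tGamma q (s - a + \<beta> + 1) * tGamma q (s + \<alpha> + b + 1)
      * tGamma q (b + \<alpha> - s) * tGamma q (\<alpha> + \<beta> + 2) * tGamma q (b - a) * tGamma q (a + b - \<beta>))
     / (tGamma q (s - a + 1) * tGamma q (s + b + 1) * tGamma q (s + a - \<beta> + 1) * tGamma q (b - s)
      * tGamma q (\<alpha> + 1) * tGamma q (\<beta> + 1) * tGamma q (b - a + \<alpha> + \<beta> + 1) * tGamma q (a + b + \<alpha> + 1))"

text \<open>
  The weight \<open>\<rho>(s) [2s+1]\<^sub>q\<close> with its removable singularities removed. In HOL, \<open>tGamma\<close> is \<open>0\<close> at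
  its poles, so for special parameters (for example \<open>\<beta>\<close> or \<open>2 * a\<close> a negative integer) the plain
  product is a junk value. The intended value is the limit over nearby regular parameters.
  Shifting \<open>a\<close>, \<open>b\<close>, \<open>s\<close> and \<open>\<beta>\<close> together by \<open>\<epsilon>\<close> keeps the integers \<open>b - a\<close>, \<open>s - a\<close> and
  \<open>b - s\<close>, while every argument in which a pole can occur moves by \<open>\<epsilon>\<close> or \<open>2 * \<epsilon>\<close>; hence the limit
  is the value obtained from \<open>tGamma q (x + 1) = qnum q x * tGamma q x\<close> by cancelling equal factors.
  Letting \<open>s\<close> alone vary would be wrong: for \<open>s = a = -1/2\<close> the factor \<open>[2s+1]\<^sub>q\<close> has to cancel
  against \<open>[s+a+1]\<^sub>q\<close>, and these agree for \<open>s = a\<close> only.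
\<close>
definition qracah_weight :: "real \<Rightarrow> real \<Rightarrow> real \<Rightarrow> real \<Rightarrow> real \<Rightarrow> real \<Rightarrow> real" where
  "qracah_weight q \<alpha> \<beta> a b s =
     Lim (at 0) (\<lambda>\<epsilon>. qracah_rho q \<alpha> (\<beta> + \<epsilon>) (a + \<epsilon>) (b + \<epsilon>) (s + \<epsilon>) * qnum q (2 * (s + \<epsilon>) + 1))"

definition dqh_x :: "real \<Rightarrow> real \<Rightarrow> real \<Rightarrow> real \<Rightarrow> real" where
  "dqh_x q \<gamma> \<delta> s = q powr (- s) + \<gamma> * \<delta> * q powr (s + 1)"

text \<open>The monic dual q-Hahn polynomial at the lattice point \<open>x(s)\<close>, as a function of \<open>s\<close>.\<close>
definition dqh :: "real \<Rightarrow> real \<Rightarrow> real \<Rightarrow> nat \<Rightarrow> nat \<Rightarrow> real \<Rightarrow> real" where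
  "dqh q \<gamma> \<delta> N n s =
     qpochs [\<gamma> * q, q powr (- real N)] q n
     * qhyp [q powr (- real n), q powr (- s), \<gamma> * \<delta> * q powr (s + 1)]
            [\<gamma> * q, q powr (- real N)] q q"

definition dqh_rho :: "real \<Rightarrow> real \<Rightarrow> real \<Rightarrow> nat \<Rightarrow> nat \<Rightarrow> real" where
  "dqh_rho q \<gamma> \<delta> N s =
     ((\<gamma> * q) ^ N * qpoch (\<delta> * q) q N / qpoch (\<gamma> * \<delta> * q\<^sup>2) q N)
     * (q powr (real N * real s - real (s choose 2)) / (- kappa q * (1 - \<gamma> * \<delta> * q) * (- \<gamma>) ^ s))
     * (qpochs [\<gamma> * q, \<gamma> * \<delta> * q, q powr (- real N)] q s
        / qpochs [q, \<gamma> * \<delta> * q ^ (N + 2), \<delta> * q] q s)"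

text \<open>
  The product of \<open>\<rho>\<close> and \<open>\<Delta>x(s - 1/2)\<close> with common factors cancelled. Both factors that may vanish in
  the denominator, \<open>1 - \<gamma> * \<delta> * q\<close> and (for \<open>s = N\<close>) \<open>1 - \<gamma> * \<delta> * q ^ (2 * N + 1)\<close>, also occur in the
  numerator, so the limit in \<open>\<gamma>\<close> is the cancelled value.
\<close>
definition dqh_weight :: "real \<Rightarrow> real \<Rightarrow> real \<Rightarrow> nat \<Rightarrow> nat \<Rightarrow> real" where
  "dqh_weight q \<gamma> \<delta> N s =
     Lim (at \<gamma>) (\<lambda>g. dqh_rho q g \<delta> N s * fdiff (dqh_x q g \<delta>) (real s - 1/2))"

text \<open>The squared norm of the dual q-Hahn polynomial.\<close>
definition dqh_norm2 :: "real \<Rightarrow> real \<Rightarrow> real \<Rightarrow> nat \<Rightarrow> nat \<Rightarrow> real" where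
  "dqh_norm2 q \<gamma> \<delta> N n =
     (\<gamma> * \<delta> * q) ^ n * qpochs [q, q powr (- real N), \<gamma> * q, inverse \<delta> * q powr (- real N)] q n"

definition mu_tilde :: "real \<Rightarrow> real \<Rightarrow> real \<Rightarrow> real" where
  "mu_tilde q a s = q powr (a + 1) * ((lattice_mu q (s + a) - lattice_c3 q) / lattice_c1 q)"

definition Ccoef :: "real \<Rightarrow> real \<Rightarrow> real \<Rightarrow> nat \<Rightarrow> real" where
  "Ccoef q \<gamma> \<delta> n = (\<gamma> * \<delta> * q) powr (real n / 2) * kappa q ^ (2 * n)"

end

theory Submission
  imports Defs
begin

text \<open>
  Put \<open>t = q\<^sup>\<alpha>\<close>. After cancellation the \<open>q\<close>-Racah weight at \<open>s\<close> is a constant times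
  \<open>h(s) / \<Prod>\<^sub>i\<^sub>\<noteq>\<^sub>s (x(s) - x(i))\<close>, where \<open>h\<close> is a quotient of \<open>q\<close>-shifted factorials, so a weighted sum of
  \<open>f\<close> is the divided difference of \<open>h f\<close> at the nodes \<open>x(0), \<dots>, x(N)\<close>. The basis functions
  \<open>(q\<^sup>-\<^sup>s, \<gamma>\<delta>q\<^sup>s\<^sup>+\<^sup>1; q)\<^sub>k\<close> of the hypergeometric series are Newton polynomials for these nodes and just drop
  the first \<open>k\<close> of them. Pairing the series with a second basis \<open>\<psi>\<^sub>j\<close>, which only shifts a parameter of
  \<open>h\<close>, leaves a single sum over \<open>k\<close> that is again a divided difference, at the nodes \<open>q\<^sup>k\<close>, and
  vanishes for \<open>j < n\<close>. Polynomials, weight and norm are continuous in \<open>t\<close> at \<open>t = 0\<close>, and the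
  relation for the dual \<open>q\<close>-Hahn polynomials follows by uniqueness of limits.
\<close>

section \<open>Divided differences and the very-well-poised sum\<close>

text \<open>Two obstacles shape the proof. Pairing one hypergeometric series with another under the
  weight gives a double sum. The second basis avoids it: multiplying the weight by
  \<open>\<psi>\<^sub>j\<close> replaces the pair (\<open>H\<close>, \<open>e\<close>) by
  (\<open>H * q ^ j\<close>, \<open>e / q ^ j\<close>), which keeps \<open>H * e\<close> and the
  relation \<open>C * q = A * H * e\<close>, hence also the nodes. The same summation formula
  therefore applies for every j. The other obstacle is the point t = 0. Orthogonality is shown for
  small t > 0, and weight, polynomials and norm are brought into closed forms in which every
  negative power of t has cancelled. The weights of the statement are limits over perturbed
  parameters. They are matched with the closed form away from the singular points first, and
  continuity of the closed form then gives the limit.\<close>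

definition divdiff :: "(nat \<Rightarrow> real) \<Rightarrow> (nat \<Rightarrow> real) \<Rightarrow> nat set \<Rightarrow> real" where
  "divdiff x f I = (\<Sum>s\<in>I. f s / (\<Prod>i\<in>I - {s}. x s - x i))"

lemma divdiff_cong: "(\<And>s. s \<in> I \<Longrightarrow> f s = g s) \<Longrightarrow> divdiff x f I = divdiff x g I"
  by (simp add: divdiff_def)

lemma divdiff_add: "divdiff x (\<lambda>s. f s + g s) I = divdiff x f I + divdiff x g I"
  by (simp add: divdiff_def add_divide_distrib sum.distrib)

lemma divdiff_cmult: "divdiff x (\<lambda>s. c * f s) I = c * divdiff x f I"
  by (simp add: divdiff_def sum_distrib_left)

lemma divdiff_sum: "divdiff x (\<lambda>s. \<Sum>k\<in>K. f k s) I = (\<Sum>k\<in>K. divdiff x (f k) I)"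
  unfolding divdiff_def by (subst sum.swap) (simp add: sum_divide_distrib)

lemma divdiff_singleton [simp]: "divdiff x f {u} = f u"
  by (simp add: divdiff_def)

text \<open>The factor vanishes at u and elsewhere cancels the difference to u in the denominator.
  Every later removal of a node rests on this.\<close>

lemma divdiff_insert_factor:
  assumes "finite I" "u \<notin> I" "inj_on x (insert u I)"
  shows "divdiff x (\<lambda>s. (x s - x u) * f s) (insert u I) = divdiff x f I"
proof -
  have "(x s - x u) * f s / (\<Prod>i\<in>insert u I - {s}. x s - x i) = f s / (\<Prod>i\<in>I - {s}. x s - x i)"
    if "s \<in> I" for s
  proof -
    have "insert u I - {s} = insert u (I - {s})" using that assms by auto
    moreover have "x s \<noteq> x u" using that assms by (auto simp: inj_on_def)
    ultimately show ?thesis using assms by simp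
  qed
  then show ?thesis using assms by (simp add: divdiff_def)
qed

text \<open>Write x v - x u as (x s - x u) - (x s - x v); each of the two factors removes one
  node.\<close>

lemma divdiff_rec:
  assumes "finite I" "u \<notin> I" "v \<notin> I" "u \<noteq> v" and inj: "inj_on x (insert u (insert v I))"
  shows "(x v - x u) * divdiff x f (insert u (insert v I))
           = divdiff x f (insert v I) - divdiff x f (insert u I)"
proof -
  let ?J = "insert u (insert v I)"
  have "(x v - x u) * divdiff x f ?J
      = divdiff x (\<lambda>s. (x s - x u) * f s) (insert u (insert v I))
        - divdiff x (\<lambda>s. (x s - x v) * f s) (insert v (insert u I))"
    by (simp add: divdiff_def sum_distrib_left insert_commute[of v u] flip: sum_subtractf diff_divide_distrib)
       (simp add: algebra_simps)
  also have "\<dots> = divdiff x f (insert v I) - divdiff x f (insert u I)"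
    using assms by (subst (1 2) divdiff_insert_factor) (auto simp: insert_commute)
  finally show ?thesis .
qed

lemma divdiff_rec_interval:
  assumes "inj_on x {k..k + Suc M}"
  shows "(x (k + Suc M) - x k) * divdiff x f {k..k + Suc M}
           = divdiff x f {Suc k..Suc k + M} - divdiff x f {k..k + M}"
proof -
  have 1: "insert k (insert (k + Suc M) {Suc k..k + M}) = {k..k + Suc M}" by auto
  have 2: "insert (k + Suc M) {Suc k..k + M} = {Suc k..Suc k + M}" by auto
  have 3: "insert k {Suc k..k + M} = {k..k + M}" by auto
  show ?thesis
    using divdiff_rec[of "{Suc k..k + M}" k "k + Suc M" x f, unfolded 1] assms
    unfolding 2 3 by simp
qed

text \<open>The difference of 1/(1 - E y) at two points is E times the difference of the points over
  both denominators, so each further node adds one power of E. The case E = 0 is included and yields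
  the divided differences of a constant.\<close>

lemma divdiff_inverse_linear:
  assumes "finite I" "I \<noteq> {}" "inj_on x I" "\<And>s. s \<in> I \<Longrightarrow> 1 - E * x s \<noteq> 0"
  shows "divdiff x (\<lambda>s. 1 / (1 - E * x s)) I = E ^ (card I - 1) / (\<Prod>s\<in>I. 1 - E * x s)"
  using assms
proof (induction "card I" arbitrary: I rule: less_induct)
  case less
  obtain u where u: "u \<in> I" using less.prems by auto
  show ?case
  proof (cases "I = {u}")
    case True
    then show ?thesis by simp
  next
    case False
    then obtain v where v: "v \<in> I" "v \<noteq> u" using u by auto
    define J where "J = I - {u, v}"
    have I: "I = insert u (insert v J)" and J: "finite J" "u \<notin> J" "v \<notin> J"
      using u v less.prems by (auto simp: J_def)
    have ne: "x v - x u \<noteq> 0" using u v less.prems by (auto simp: inj_on_def)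
    have nu: "1 - E * x u \<noteq> 0" and nv: "1 - E * x v \<noteq> 0" using less.prems u v by auto
    have inj: "inj_on x (insert u J)" "inj_on x (insert v J)" "inj_on x (insert u (insert v J))"
      using less.prems(3) unfolding I by (auto simp: inj_on_def)
    let ?P = "\<Prod>s\<in>J. 1 - E * x s"
    have P: "?P \<noteq> 0" using less.prems J I by auto
    have 1: "divdiff x (\<lambda>s. 1 / (1 - E * x s)) (insert v J) = E ^ card J / ((1 - E * x v) * ?P)"
      using less.hyps[of "insert v J"] less.prems(4) inj J v I by auto
    have 2: "divdiff x (\<lambda>s. 1 / (1 - E * x s)) (insert u J) = E ^ card J / ((1 - E * x u) * ?P)"
      using less.hyps[of "insert u J"] less.prems(4) inj J v I by auto
    have "(x v - x u) * divdiff x (\<lambda>s. 1 / (1 - E * x s)) I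
            = E ^ card J / ((1 - E * x v) * ?P) - E ^ card J / ((1 - E * x u) * ?P)"
      unfolding I using divdiff_rec[OF J v(2)[symmetric] inj(3)] 1 2 by simp
    also have "\<dots> = (x v - x u) * (E ^ Suc (card J) / ((1 - E * x u) * ((1 - E * x v) * ?P)))"
      using nu nv P by (simp add: divide_simps) (simp add: algebra_simps)
    finally have "divdiff x (\<lambda>s. 1 / (1 - E * x s)) I
        = E ^ Suc (card J) / ((1 - E * x u) * ((1 - E * x v) * ?P))"
      using ne by (metis mult_left_cancel)
    then show ?thesis using J v by (simp add: I)
  qed
qed

lemma divdiff_one:
  assumes "finite I" "2 \<le> card I" "inj_on x I"
  shows "divdiff x (\<lambda>s. 1) I = 0"
  using divdiff_inverse_linear[of I x 0] assms by (cases "I = {}") (auto simp: power_0_left)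

text \<open>Synthetic division at c. The degree clauses single out constant polynomials, whose
  degree cannot drop any further.\<close>

lemma poly_split_at:
  fixes p :: "real poly"
  shows "\<exists>r. p = [:poly p c:] + [:- c, 1:] * r \<and> (degree p = 0 \<longrightarrow> r = 0)
           \<and> (degree p > 0 \<longrightarrow> degree r < degree p)"
proof (intro exI conjI impI)
  show eq: "p = [:poly p c:] + [:- c, 1:] * synthetic_div p c"
    using synthetic_div_correct'[of c p] by (simp add: add.commute)
  show "synthetic_div p c = 0" if "degree p = 0" using that by (simp add: synthetic_div_eq_0_iff)
  show "degree (synthetic_div p c) < degree p" if "degree p > 0" using that by (simp add: degree_synthetic_div)
qed

text \<open>Splitting off the value at a node u removes that node and one degree together, so the
  gap between degree and number of nodes survives the induction.\<close>

lemma divdiff_poly: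
  assumes "finite I" "inj_on x I" "degree p + 1 < card I"
  shows "divdiff x (\<lambda>s. poly p (x s)) I = 0"
  using assms
proof (induction I arbitrary: p rule: finite_induct)
  case (insert u I)
  obtain r where r: "p = [:poly p (x u):] + [:- x u, 1:] * r" "degree p = 0 \<longrightarrow> r = 0"
    "degree p > 0 \<longrightarrow> degree r < degree p" using poly_split_at by blast
  have p: "poly p y = poly p (x u) * 1 + (y - x u) * poly r y" for y
    by (subst r(1)) (simp add: algebra_simps)
  have "divdiff x (\<lambda>s. poly p (x s)) (insert u I)
      = divdiff x (\<lambda>s. poly p (x u) * 1 + (x s - x u) * poly r (x s)) (insert u I)"
    by (rule divdiff_cong) (rule p)
  also have "\<dots> = poly p (x u) * divdiff x (\<lambda>s. 1) (insert u I) + divdiff x (\<lambda>s. poly r (x s)) I"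
    unfolding divdiff_add divdiff_cmult
    by (simp only: divdiff_insert_factor[OF insert.hyps(1,2) insert.prems(1)])
  also have "divdiff x (\<lambda>s. 1) (insert u I) = 0" using insert by (intro divdiff_one) auto
  also have "divdiff x (\<lambda>s. poly r (x s)) I = 0"
  proof (cases "degree p = 0")
    case True
    then show ?thesis using r by (simp add: divdiff_def)
  next
    case False
    then show ?thesis using r insert by (intro insert.IH) (auto simp: inj_on_def)
  qed
  finally show ?case by simp
qed simp

text \<open>Division by the linear factor leaves a multiple of 1/(1 - E y) and a polynomial of lower
  degree. The divided difference annihilates the latter, and only the value of p at the pole 1/E
  survives.\<close>

lemma divdiff_poly_over_linear:
  assumes "finite I" "inj_on x I" "\<And>s. s \<in> I \<Longrightarrow> 1 - E * x s \<noteq> 0" "E \<noteq> 0" "degree p < card I"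
  shows "divdiff x (\<lambda>s. poly p (x s) / (1 - E * x s)) I
           = poly p (1 / E) * E ^ (card I - 1) / (\<Prod>s\<in>I. 1 - E * x s)"
proof -
  obtain r where r: "p = [:poly p (1/E):] + [:- (1/E), 1:] * r" "degree p = 0 \<longrightarrow> r = 0"
    "degree p > 0 \<longrightarrow> degree r < degree p" using poly_split_at by blast
  have p: "poly p y = poly p (1/E) + (y - 1/E) * poly r y" for y
    by (subst r(1)) (simp add: algebra_simps)
  have "divdiff x (\<lambda>s. poly p (x s) / (1 - E * x s)) I
      = divdiff x (\<lambda>s. poly p (1/E) * (1 / (1 - E * x s)) + (- 1 / E) * poly r (x s)) I"
  proof (rule divdiff_cong)
    fix s assume s: "s \<in> I"
    show "poly p (x s) / (1 - E * x s) = poly p (1/E) * (1 / (1 - E * x s)) + (- 1 / E) * poly r (x s)"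
      unfolding p[of "x s"] using assms(3)[OF s] \<open>E \<noteq> 0\<close> by (simp add: divide_simps) (simp add: algebra_simps)
  qed
  also have "\<dots> = poly p (1/E) * divdiff x (\<lambda>s. 1 / (1 - E * x s)) I
                   + (- 1 / E) * divdiff x (\<lambda>s. poly r (x s)) I"
    by (simp only: divdiff_add divdiff_cmult)
  also have "divdiff x (\<lambda>s. poly r (x s)) I = 0"
  proof (cases "degree p = 0")
    case True
    then show ?thesis using r by (simp add: divdiff_def)
  next
    case False
    then show ?thesis using r assms by (intro divdiff_poly) auto
  qed
  also have "divdiff x (\<lambda>s. 1 / (1 - E * x s)) I = E ^ (card I - 1) / (\<Prod>s\<in>I. 1 - E * x s)"
    using assms by (intro divdiff_inverse_linear) auto
  finally show ?thesis by simp
qed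

section \<open>q-shifted factorials and the lattice nodes\<close>

lemma qpoch_0 [simp]: "qpoch x q 0 = 1"
  by (simp add: qpoch_def)

lemma qpoch_Suc: "qpoch x q (Suc k) = qpoch x q k * (1 - x * q ^ k)"
  by (simp add: qpoch_def)

lemma qpoch_add: "qpoch x q (m + n) = qpoch x q m * qpoch (x * q ^ m) q n"
  by (induction n) (simp_all add: qpoch_Suc power_add algebra_simps)

lemma qpoch_Suc_left: "qpoch x q (Suc k) = (1 - x) * qpoch (x * q) q k"
  using qpoch_add[of x q 1 k] by (simp add: qpoch_Suc)

lemma qpoch_nonzero: "(\<And>i. i < k \<Longrightarrow> x * q ^ i \<noteq> 1) \<Longrightarrow> qpoch x q k \<noteq> 0"
  by (simp add: qpoch_def)

lemma qpoch_self_nonzero: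
  assumes "0 < q" "q < (1::real)"
  shows "qpoch q q k \<noteq> 0"
  using assms by (intro qpoch_nonzero) (metis power_Suc less_irrefl power_Suc_less_one)

lemma qpoch_neg_power_nonzero:
  assumes "0 < q" "q < (1::real)" "k \<le> n"
  shows "qpoch (1 / q ^ n) q k \<noteq> 0"
proof (rule qpoch_nonzero)
  fix i assume "i < k"
  then have "q ^ n < q ^ i" using assms by (intro power_strict_decreasing) auto
  then have "q ^ n \<noteq> q ^ i" by (rule less_imp_neq)
  then show "1 / q ^ n * q ^ i \<noteq> 1" using assms(1) by auto
qed

text \<open>Each factor is turned by 1 - 1/y = -(1/y) (1 - y). The powers of q stay a product over
  i, so that they can be merged factor by factor with other such products.\<close>

lemma qpoch_reverse:
  assumes "x \<noteq> 0" "q \<noteq> 0"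
  shows "qpoch (1 / (x * q ^ n)) q n = (\<Prod>i<n. - 1 / (x * q ^ Suc i)) * qpoch (x * q) q n"
proof (induction n)
  case (Suc n)
  have "qpoch (1 / (x * q ^ Suc n)) q (Suc n)
     = (1 - 1 / (x * q ^ Suc n)) * qpoch (1 / (x * q ^ n)) q n"
    using assms by (simp add: qpoch_Suc_left field_simps)
  also have "1 - 1 / (x * q ^ Suc n) = - 1 / (x * q ^ Suc n) * (1 - x * q * q ^ n)"
    using assms by (simp add: field_simps)
  finally show ?case using Suc by (simp add: qpoch_Suc)
qed simp

text \<open>With C = \<gamma>\<delta>q this is the dual q-Hahn lattice x(s) at the integers.\<close>

definition qlat :: "real \<Rightarrow> real \<Rightarrow> nat \<Rightarrow> real" where
  "qlat q C s = 1 / q ^ s + C * q ^ s"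

text \<open>The part of the very-well-poised summand that the node differences do not supply. Under
  \<open>C * q = A * H * e\<close> the lower parameters \<open>H * e\<close> and
  \<open>A * e\<close> are Cq/A and Cq/H, the well-poised partners of A and H.\<close>

definition vwp :: "real \<Rightarrow> real \<Rightarrow> real \<Rightarrow> real \<Rightarrow> nat \<Rightarrow> real" where
  "vwp q A H e s = qpoch A q s * qpoch H q s / (qpoch (H * e) q s * qpoch (A * e) q s) * e ^ s"

lemma qlat_diff:
  assumes "q \<noteq> 0"
  shows "qlat q C (i + j) - qlat q C i = (1 - q ^ j) * (1 - C * q ^ (i + i + j)) / q ^ (i + j)"
  using assms by (simp add: qlat_def divide_simps power_add) (simp add: algebra_simps)

lemma inj_on_qlat:
  assumes "0 < q" "q < 1" "\<And>i j. i < j \<Longrightarrow> j \<le> N \<Longrightarrow> C * q ^ (i + j) \<noteq> 1"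
  shows "inj_on (qlat q C) {0..N}"
proof (rule linorder_inj_onI)
  fix i j assume ij: "i < j" "i \<in> {0..N}" "j \<in> {0..N}"
  have "q ^ (j - i) < 1" using assms ij by (simp add: power_less_one_iff)
  moreover have "C * q ^ (i + i + (j - i)) \<noteq> 1" using assms(3)[of i j] ij by simp
  ultimately show "qlat q C i \<noteq> qlat q C j"
    using qlat_diff[of q C i "j - i"] ij assms by auto
qed auto

text \<open>This is the terminating very-well-poised \<open>\<^sub>6\<phi>\<^sub>5\<close> sum. The factors
  \<open>(1 - C q\<^sup>2\<^sup>s) (C; q)\<^sub>s\<close> of its summand are those of the product of node differences, so the
  recursion of divided differences proves it by induction on the number of nodes.\<close>

lemma divdiff_vwp:
  assumes q: "0 < q" "q < 1" and C: "C * q = A * H * e"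
    and He: "\<And>i. i < k + M \<Longrightarrow> H * e * q ^ i \<noteq> 1" and Ae: "\<And>i. i < k + M \<Longrightarrow> A * e * q ^ i \<noteq> 1"
    and inj: "inj_on (qlat q C) {0..k + M}"
  shows "divdiff (qlat q C) (vwp q A H e) {k..k + M} =
    vwp q A H e k * (\<Prod>i<M. - (q ^ (k + i + 1))) * qpoch e q M
      / (qpoch q q M * qpoch (H * e * q ^ k) q M * qpoch (A * e * q ^ k) q M)"
  using He Ae inj
proof (induction M arbitrary: k)
  case (Suc M)
  define u v where "u = q ^ k" and "v = q ^ M"
  have uv: "u > 0" "v > 0" using q by (auto simp: u_def v_def)
  let ?x = "qlat q C" and ?h = "vwp q A H e"
  let ?D = "divdiff ?x ?h"
  have inj': "inj_on ?x {k..k + Suc M}" using Suc.prems(3) by (rule inj_on_subset) auto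
  have rec: "(?x (k + Suc M) - ?x k) * ?D {k..k + Suc M} = ?D {Suc k..Suc k + M} - ?D {k..k + M}"
    using inj' by (rule divdiff_rec_interval)
  have xd: "?x (k + Suc M) - ?x k = (1 - q * v) * (1 - C * q * u\<^sup>2 * v) / (q * u * v)"
    using qlat_diff[of q C k "Suc M"] q
    by (simp add: u_def v_def power_add power2_eq_square algebra_simps)
  have ne: "?x (k + Suc M) - ?x k \<noteq> 0"
    using inj_onD[OF inj', of "k + Suc M" k] by auto
  have qv: "1 - q * v \<noteq> 0" using ne xd by auto
  let ?p = "qpoch (H * e * q ^ k) q" and ?r = "qpoch (A * e * q ^ k) q"
  let ?T = "\<Prod>i<M. - (q ^ (k + i + 1))"
  have pr: "H * e * u * v \<noteq> 1" "A * e * u * v \<noteq> 1" "H * e * u \<noteq> 1" "A * e * u \<noteq> 1"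
    using Suc.prems(1)[of "k + M"] Suc.prems(2)[of "k + M"] Suc.prems(1)[of k] Suc.prems(2)[of k]
    by (auto simp: u_def v_def power_add mult.assoc)
  have pM: "?p M \<noteq> 0" "?r M \<noteq> 0"
    using Suc.prems(1)[of "k + _"] Suc.prems(2)[of "k + _"]
    by (auto intro!: qpoch_nonzero simp: power_add mult.assoc)
  have q0: "qpoch q q M \<noteq> 0" using q by (rule qpoch_self_nonzero)
  have D1: "?D {k..k + M} = ?h k * ?T * qpoch e q M / (qpoch q q M * ?p M * ?r M)"
    using Suc.prems by (intro Suc.IH) (auto intro: inj_on_subset)
  have hk: "?h (Suc k) = ?h k * ((1 - A * u) * (1 - H * u) * e / ((1 - H * e * u) * (1 - A * e * u)))"
    by (simp add: vwp_def qpoch_Suc u_def mult_ac)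
  have shift: "qpoch (H * e * q ^ Suc k) q M * (1 - H * e * u) = ?p M * (1 - H * e * u * v)"
     "qpoch (A * e * q ^ Suc k) q M * (1 - A * e * u) = ?r M * (1 - A * e * u * v)"
    using qpoch_Suc[of "H * e * q ^ k" q M] qpoch_Suc_left[of "H * e * q ^ k" q M]
      qpoch_Suc[of "A * e * q ^ k" q M] qpoch_Suc_left[of "A * e * q ^ k" q M]
    by (simp_all add: u_def v_def mult.assoc mult.commute mult.left_commute)
  have "(\<Prod>i<M. - (q ^ (Suc k + i + 1))) = (\<Prod>i<M. - (q ^ (k + i + 1)) * q)"
    by (simp add: mult_ac)
  then have T: "(\<Prod>i<M. - (q ^ (Suc k + i + 1))) = ?T * v"
    by (simp only: prod.distrib prod_constant v_def card_lessThan)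
  have "?D {Suc k..Suc k + M} = ?h (Suc k) * (?T * v) * qpoch e q M
      / (qpoch q q M * qpoch (H * e * q ^ Suc k) q M * qpoch (A * e * q ^ Suc k) q M)"
    unfolding T[symmetric] using Suc.prems by (intro Suc.IH) (auto intro: inj_on_subset)
  also have "\<dots> = ?h k * ((1 - A * u) * (1 - H * u) * e) * (?T * v) * qpoch e q M
      / (qpoch q q M * (qpoch (H * e * q ^ Suc k) q M * (1 - H * e * u))
           * (qpoch (A * e * q ^ Suc k) q M * (1 - A * e * u)))"
    unfolding hk by simp
  finally have D2: "?D {Suc k..Suc k + M} = ?h k * ((1 - A * u) * (1 - H * u) * e) * (?T * v) * qpoch e q M
      / (qpoch q q M * (?p M * (1 - H * e * u * v)) * (?r M * (1 - A * e * u * v)))"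
    unfolding shift .
  \<comment> \<open>Here the relation between C and A, H, e enters. The terms linear in u cancel,
    and what is left contains the factor 1 - C q u^2 v of the node difference, which can then be
    divided out.\<close>
  have key: "v * e * (1 - A * u) * (1 - H * u) - (1 - H * e * u * v) * (1 - A * e * u * v)
      = - ((1 - C * q * u\<^sup>2 * v) * (1 - e * v))"
    unfolding C by (simp add: algebra_simps power2_eq_square)
  define X where "X = ?h k * ?T * qpoch e q M / (qpoch q q M * ?p M * ?r M * ((1 - H * e * u * v) * (1 - A * e * u * v)))"
  have "?D {Suc k..Suc k + M} = X * (v * e * (1 - A * u) * (1 - H * u))"
    unfolding D2 X_def by (simp add: mult_ac)
  moreover have "?D {k..k + M} = X * ((1 - H * e * u * v) * (1 - A * e * u * v))"
    unfolding D1 X_def using pr by simp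
  ultimately have "(?x (k + Suc M) - ?x k) * ?D {k..k + Suc M}
     = X * (v * e * (1 - A * u) * (1 - H * u) - (1 - H * e * u * v) * (1 - A * e * u * v))"
    unfolding rec by (simp only: right_diff_distrib)
  also have "\<dots> = (?x (k + Suc M) - ?x k) * (- (q * u * v) / (1 - q * v) * (1 - e * v) * X)"
    unfolding key xd using qv uv q by (simp add: mult_ac)
  finally have "?D {k..k + Suc M} = - (q * u * v) / (1 - q * v) * (1 - e * v) * X"
    by (simp only: mult_left_cancel[OF ne])
  moreover have "(\<Prod>i<Suc M. - (q ^ (k + i + 1))) = ?T * (- (q * u * v))"
    by (simp add: u_def v_def power_add)
  moreover have "qpoch e q (Suc M) = qpoch e q M * (1 - e * v)"
    "qpoch q q (Suc M) = qpoch q q M * (1 - q * v)"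
    "?p (Suc M) = ?p M * (1 - H * e * u * v)" "?r (Suc M) = ?r M * (1 - A * e * u * v)"
    by (simp_all only: qpoch_Suc u_def v_def)
  moreover have "- w / a * b * (h * T * E / (Q * P * R * (c * d)))
      = h * (T * (- w)) * (E * b) / ((Q * a) * (P * c) * (R * d))" for w a b c d h T E Q P R :: real
    by (simp add: mult_ac)
  ultimately show ?case
    by (simp only: X_def)
qed simp

section \<open>Newton bases and the balanced sum\<close>

lemma degree_prod_linear_le: "degree (\<Prod>i<n. [:a i, b i:]) \<le> n"
  for a b :: "nat \<Rightarrow> real"
proof (induction n)
  case (Suc n)
  have "degree ((\<Prod>i<n. [:a i, b i:]) * [:a n, b n:]) \<le> n + 1"
    by (rule order_trans[OF degree_mult_le add_mono[OF Suc.IH]]) simp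
  then show ?case by simp
qed simp

lemma coeff_prod_linear: "coeff (\<Prod>i<n. [:a i, b i:]) n = (\<Prod>i<n. b i)"
  for a b :: "nat \<Rightarrow> real"
proof (induction n)
  case (Suc n)
  have "coeff (\<Prod>i<n. [:a i, b i:]) (Suc n) = 0"
    using degree_prod_linear_le[of a b n] by (intro coeff_eq_0) simp
  then show ?case using Suc by (simp add: mult.commute[of _ "[:a n, b n:]"])
qed simp

lemma coeff_prod_linear_eq_0: "n < m \<Longrightarrow> coeff (\<Prod>i<n. [:a i, b i:]) m = 0"
  for a b :: "nat \<Rightarrow> real"
  using degree_prod_linear_le[of a b n] by (intro coeff_eq_0) simp

text \<open>Anything of degree below n is a combination of P 0, ..., P (n - 1), hence killed;
  subtracting a multiple of P n brings p into that range. With L the pairing against a series and P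
  the second basis, one evaluation gives both orthogonality and norm.\<close>

lemma linear_functional_leading_coeff:
  fixes L :: "real poly \<Rightarrow> real" and P :: "nat \<Rightarrow> real poly"
  assumes add: "\<And>p r. L (p + r) = L p + L r" and smult: "\<And>c p. L (smult c p) = c * L p"
    and P0: "\<And>i j. i < j \<Longrightarrow> coeff (P i) j = 0" and P1: "\<And>i. coeff (P i) i \<noteq> 0"
    and LP: "\<And>i. i < n \<Longrightarrow> L (P i) = 0" and p: "\<And>i. n < i \<Longrightarrow> coeff p i = 0"
  shows "L p = coeff p n / coeff (P n) n * L (P n)"
proof -
  have low: "m \<le> n \<Longrightarrow> (\<And>i. m \<le> i \<Longrightarrow> coeff p i = 0) \<Longrightarrow> L p = 0" for m p
  proof (induction m arbitrary: p)
    case 0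
    then have "p = smult 0 p" by (simp add: poly_eq_iff)
    then show ?case using smult[of 0 p] by simp
  next
    case (Suc m)
    define c where "c = coeff p m / coeff (P m) m"
    have "coeff (p + smult (- c) (P m)) i = 0" if "m \<le> i" for i
      using Suc.prems(2)[of i] P0[of m i] P1[of m] that by (cases "i = m") (auto simp: c_def)
    then have "L (p + smult (- c) (P m)) = 0" using Suc by simp
    moreover have "L (p + smult (- c) (P m)) = L p + - c * L (P m)" by (simp only: add smult)
    ultimately show ?case using LP[of m] Suc.prems by simp
  qed
  define c where "c = coeff p n / coeff (P n) n"
  have "coeff (p + smult (- c) (P n)) i = 0" if "n \<le> i" for i
    using p[of i] P0[of n i] P1[of n] that by (cases "i = n") (auto simp: c_def)
  then have "L (p + smult (- c) (P n)) = 0" using low[of n] by simp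
  moreover have "L (p + smult (- c) (P n)) = L p + - c * L (P n)" by (simp only: add smult)
  ultimately show ?thesis by (simp add: c_def)
qed

lemma divdiff_newton:
  assumes "inj_on x {0..N}" "k \<le> N"
  shows "divdiff x (\<lambda>s. (\<Prod>i<k. x s - x i) * f s) {0..N} = divdiff x f {k..N}"
  using assms(2)
proof (induction k arbitrary: f)
  case (Suc k)
  have "divdiff x (\<lambda>s. (\<Prod>i<Suc k. x s - x i) * f s) {0..N}
      = divdiff x (\<lambda>s. (\<Prod>i<k. x s - x i) * ((x s - x k) * f s)) {0..N}"
    by (simp add: mult.assoc)
  also have "\<dots> = divdiff x (\<lambda>s. (x s - x k) * f s) {k..N}" using Suc by simp
  also have "{k..N} = insert k {Suc k..N}" using Suc.prems by auto
  also have "divdiff x (\<lambda>s. (x s - x k) * f s) (insert k {Suc k..N}) = divdiff x f {Suc k..N}"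
    by (rule divdiff_insert_factor) (use Suc.prems in \<open>auto intro!: inj_on_subset[OF assms(1)] dest: inj_onD[OF assms(1)]\<close>)
  finally show ?case .
qed simp

section \<open>The Newton basis of the series under the weight\<close>

definition phi_poly :: "real \<Rightarrow> real \<Rightarrow> nat \<Rightarrow> real poly" where
  "phi_poly q C k = (\<Prod>i<k. [:1 + C * q ^ (i + i), - (q ^ i):])"

lemma poly_phi_newton:
  assumes "q \<noteq> 0"
  shows "poly (phi_poly q C k) y = (\<Prod>i<k. - (q ^ i)) * (\<Prod>i<k. y - qlat q C i)"
  using assms unfolding phi_poly_def poly_prod prod.distrib[symmetric]
  by (intro prod.cong) (simp_all add: qlat_def field_simps power_add)

lemma poly_phi:
  assumes "q \<noteq> 0"
  shows "poly (phi_poly q C k) (qlat q C s) = qpoch (1 / q ^ s) q k * qpoch (C * q ^ s) q k"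
  using assms unfolding phi_poly_def poly_prod qpoch_def prod.distrib[symmetric]
  by (intro prod.cong) (simp_all add: qlat_def field_simps power_add)

text \<open>Dropping the first k nodes leaves a divided difference over the remaining ones, for
  which \<open>divdiff_vwp\<close> has a closed form too. Consecutive closed forms differ by
  elementary factors, so induction on k gives the quotient of factorials. This is what allows the
  sum over s to be carried out term by term in the series.\<close>

lemma divdiff_phi_vwp:
  assumes q: "0 < q" "q < 1" and C: "C * q = A * H * e" and e: "e \<noteq> 0"
    and He: "\<And>i. i < N \<Longrightarrow> H * e * q ^ i \<noteq> 1" and Ae: "\<And>i. i < N \<Longrightarrow> A * e * q ^ i \<noteq> 1"
    and en: "\<And>i. i < N \<Longrightarrow> e * q ^ i \<noteq> 1"
    and inj: "inj_on (qlat q C) {0..N}" and k: "k \<le> N"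
  shows "divdiff (qlat q C) (\<lambda>s. poly (phi_poly q C k) (qlat q C s) * vwp q A H e s) {0..N}
     = divdiff (qlat q C) (vwp q A H e) {0..N}
       * (qpoch A q k * qpoch H q k * qpoch (1 / q ^ N) q k / qpoch (q / (e * q ^ N)) q k)"
proof -
  let ?D = "divdiff (qlat q C) (vwp q A H e)"
  have 1: "divdiff (qlat q C) (\<lambda>s. poly (phi_poly q C k) (qlat q C s) * vwp q A H e s) {0..N}
      = (\<Prod>i<k. - (q ^ i)) * ?D {k..N}"
    using q unfolding poly_phi_newton[OF less_imp_neq[OF q(1), symmetric]] mult.assoc divdiff_cmult
    by (subst divdiff_newton[OF inj k]) simp
  have "(\<Prod>i<k. - (q ^ i)) * ?D {k..N} = ?D {0..N}
       * (qpoch A q k * qpoch H q k * qpoch (1 / q ^ N) q k / qpoch (q / (e * q ^ N)) q k)"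
    using k
  proof (induction k)
    case (Suc k)
    define M where "M = N - Suc k"
    have N: "N = Suc k + M" using Suc.prems by (simp add: M_def)
    let ?p = "qpoch (H * e * q ^ Suc k) q M" and ?r = "qpoch (A * e * q ^ Suc k) q M"
    let ?T = "\<Prod>i<M. - (q ^ (Suc k + i + 1))"
    define h where "h = vwp q A H e k"
    have ne: "1 - H * e * q ^ k \<noteq> 0" "1 - A * e * q ^ k \<noteq> 0" "1 - e * q ^ M \<noteq> 0"
      using He[of k] Ae[of k] en[of M] N by auto
    have "q ^ Suc M < 1" using q by (simp add: power_less_one_iff del: power_Suc)
    then have qM: "1 - q * q ^ M \<noteq> 0" by simp
    have hk: "vwp q A H e (Suc k)
       = h * ((1 - A * q ^ k) * (1 - H * q ^ k) * e / ((1 - H * e * q ^ k) * (1 - A * e * q ^ k)))"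
      by (simp add: vwp_def qpoch_Suc h_def mult_ac)
    have D1: "?D {Suc k..N} = vwp q A H e (Suc k) * ?T * qpoch e q M / (qpoch q q M * ?p * ?r)"
      unfolding N by (rule divdiff_vwp[OF q C]) (use He Ae inj N in auto)
    have "?D {k..k + Suc M} = h * (\<Prod>i<Suc M. - (q ^ (k + i + 1))) * qpoch e q (Suc M)
      / (qpoch q q (Suc M) * qpoch (H * e * q ^ k) q (Suc M) * qpoch (A * e * q ^ k) q (Suc M))"
      unfolding h_def by (rule divdiff_vwp[OF q C]) (use He Ae inj N in auto)
    moreover have "(\<Prod>i<Suc M. - (q ^ (k + i + 1))) = - (q * q ^ k) * ?T"
      by (subst prod.lessThan_Suc_shift) simp
    moreover have "qpoch (H * e * q ^ k) q (Suc M) = (1 - H * e * q ^ k) * ?p"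
      "qpoch (A * e * q ^ k) q (Suc M) = (1 - A * e * q ^ k) * ?r"
      by (simp_all add: qpoch_Suc_left mult_ac)
    ultimately have D0: "?D {k..N} = h * (- (q * q ^ k) * ?T) * (qpoch e q M * (1 - e * q ^ M))
      / ((qpoch q q M * (1 - q * q ^ M)) * ((1 - H * e * q ^ k) * ?p) * ((1 - A * e * q ^ k) * ?r))"
      by (simp add: N qpoch_Suc)
    have gen: "a * (h * (b * e / (c * c')) * T * E / (Q * P * R))
        = (h * (- (z * w) * T) * (E * x) / ((Q * y) * (c * P) * (c' * R))) * (b * (- a * e * y / (z * w * x)))"
      if "x \<noteq> 0" "y \<noteq> 0" "z \<noteq> 0" "w \<noteq> 0" for a h b e c c' T E Q P R x y z w :: real
      using that by (simp add: mult_ac)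
    have "- (q ^ k) * ?D {Suc k..N} = ?D {k..N} * ((1 - A * q ^ k) * (1 - H * q ^ k)
           * (- (- (q ^ k)) * e * (1 - q * q ^ M) / (q * q ^ k * (1 - e * q ^ M))))"
      unfolding D1 D0 hk
      by (rule gen) (use ne qM q in simp_all)
    \<comment> \<open>Since q^M = q^N / q^(k+1), the left-over elementary factors are the next
      factors of (q^-N; q)_k and of (q/(e q^N); q)_k.\<close>
    also have "- (- (q ^ k)) * e * (1 - q * q ^ M) / (q * q ^ k * (1 - e * q ^ M))
       = (1 - 1 / q ^ N * q ^ k) / (1 - q / (e * q ^ N) * q ^ k)"
      using ne(3) q e by (simp add: N power_add divide_simps) (simp add: algebra_simps)
    finally have step: "- (q ^ k) * ?D {Suc k..N} = ?D {k..N} * ((1 - A * q ^ k) * (1 - H * q ^ k)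
           * ((1 - 1 / q ^ N * q ^ k) / (1 - q / (e * q ^ N) * q ^ k)))" .
    have "(\<Prod>i<Suc k. - (q ^ i)) * ?D {Suc k..N} = (\<Prod>i<k. - (q ^ i)) * (- (q ^ k) * ?D {Suc k..N})"
      by simp
    also have "\<dots> = ((\<Prod>i<k. - (q ^ i)) * ?D {k..N}) * ((1 - A * q ^ k) * (1 - H * q ^ k)
           * ((1 - 1 / q ^ N * q ^ k) / (1 - q / (e * q ^ N) * q ^ k)))"
      unfolding step by simp
    also have "(\<Prod>i<k. - (q ^ i)) * ?D {k..N} = ?D {0..N}
       * (qpoch A q k * qpoch H q k * qpoch (1 / q ^ N) q k / qpoch (q / (e * q ^ N)) q k)"
      using Suc by simp
    finally show ?case by (simp add: qpoch_Suc mult_ac)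
  qed simp
  with 1 show ?thesis by simp
qed

section \<open>Geometric nodes and the balanced sum\<close>

lemma qpoch_swap: "qpoch x q m * qpoch (x * q ^ m) q k = qpoch x q k * qpoch (x * q ^ k) q m"
  using qpoch_add[of x q m k] qpoch_add[of x q k m] by (simp add: add.commute)

lemma prod_one_minus_power_rev: "(\<Prod>i<s. 1 - q ^ (s - i)) = qpoch q q s"
proof -
  have "(\<Prod>i<s. 1 - q ^ (s - i)) = (\<Prod>i<s. 1 - q ^ Suc (s - Suc i))"
    by (intro prod.cong) (simp_all add: Suc_diff_Suc del: power_Suc)
  also have "\<dots> = qpoch q q s"
    using prod.nat_diff_reindex[of "\<lambda>i. 1 - q ^ Suc i" s] by (simp add: qpoch_def)
  finally show ?thesis .
qed

text \<open>Up to (q; q)_n, the q-binomial weight is the barycentric weight of the nodes 1, q, ...,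
  q^n, so a terminating series becomes a divided difference in q^k. The induction starts at n = k
  because each later node contributes a single factor.\<close>

lemma q_weight_eq_divdiff_weight:
  assumes q: "0 < q" "q < (1::real)" and k: "k \<le> n"
  shows "qpoch (1 / q ^ n) q k / qpoch q q k * q ^ k = qpoch q q n / (\<Prod>i\<in>{0..n} - {k}. q ^ k - q ^ i)"
  using k
proof (induction n rule: dec_induct)
  case base
  have q0: "qpoch q q k \<noteq> 0" using q by (rule qpoch_self_nonzero)
  have "{0..k} - {k} = {..<k}" by auto
  then have "(\<Prod>i\<in>{0..k} - {k}. q ^ k - q ^ i) = (\<Prod>i<k. - (q ^ i) * (1 - q ^ (k - i)))"
    using q by (auto intro!: prod.cong simp: algebra_simps simp flip: power_add)
  also have "\<dots> = (\<Prod>i<k. - (q ^ i)) * (\<Prod>i<k. 1 - q ^ (k - i))"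
    by (rule prod.distrib)
  also have "(\<Prod>i<k. 1 - q ^ (k - i)) = qpoch q q k"
    by (rule prod_one_minus_power_rev)
  finally have 1: "(\<Prod>i\<in>{0..k} - {k}. q ^ k - q ^ i) = (\<Prod>i<k. - (q ^ i)) * qpoch q q k" .
  have "(\<Prod>i<k. - (q ^ i)) * (\<Prod>i<k. - 1 / (1 * q ^ Suc i)) = (\<Prod>i<k. 1 / q)"
    unfolding prod.distrib[symmetric] using q by (intro prod.cong) auto
  then have 2: "(\<Prod>i<k. - (q ^ i)) * (\<Prod>i<k. - 1 / (1 * q ^ Suc i)) = 1 / q ^ k"
    by (simp add: power_divide)
  have 3: "(\<Prod>i<k. - (q ^ i)) \<noteq> 0" using q by simp
  have 4: "qpoch (1 / q ^ k) q k = (\<Prod>i<k. - 1 / (1 * q ^ Suc i)) * qpoch q q k"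
    using qpoch_reverse[of 1 q k] q by simp
  have "(\<Prod>i<k. - (q ^ i)) * (qpoch (1 / q ^ k) q k * q ^ k) = qpoch q q k"
    unfolding 4 using 2 q by (simp add: mult.assoc[symmetric] del: prod_dividef)
  then show ?case using 1 3 q0 by (simp add: divide_simps mult_ac)
next
  case (step n)
  have S: "{0..Suc n} - {k} = insert (Suc n) ({0..n} - {k})" using step by auto
  have "q ^ Suc n < q ^ k" using q step by (intro power_strict_decreasing) auto
  then have ne: "q ^ k - q ^ Suc n \<noteq> 0" by simp
  have "(1 - 1 / q ^ Suc n * q ^ k) * qpoch (1 / q ^ Suc n) q k = (1 - 1 / q ^ Suc n) * qpoch (1 / q ^ n) q k"
    using qpoch_Suc_left[of "1 / q ^ Suc n" q k] qpoch_Suc[of "1 / q ^ Suc n" q k] q by (simp add: field_simps)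
  moreover have "1 - 1 / q ^ Suc n * q ^ k = - (q ^ k - q ^ Suc n) / q ^ Suc n"
     "1 - 1 / q ^ Suc n = - (1 - q * q ^ n) / q ^ Suc n"
    using q by (simp_all add: field_simps)
  ultimately have "- (q ^ k - q ^ Suc n) / q ^ Suc n * qpoch (1 / q ^ Suc n) q k
      = - (1 - q * q ^ n) / q ^ Suc n * qpoch (1 / q ^ n) q k"
    by (simp only:)
  then have "(q ^ k - q ^ Suc n) * qpoch (1 / q ^ Suc n) q k = (1 - q * q ^ n) * qpoch (1 / q ^ n) q k"
    using q by (simp add: field_simps)
  then have *: "qpoch (1 / q ^ Suc n) q k = (1 - q * q ^ n) / (q ^ k - q ^ Suc n) * qpoch (1 / q ^ n) q k"
    using ne by (simp add: field_simps)
  have "qpoch (1 / q ^ Suc n) q k / qpoch q q k * q ^ k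
     = (1 - q * q ^ n) / (q ^ k - q ^ Suc n) * (qpoch (1 / q ^ n) q k / qpoch q q k * q ^ k)"
    unfolding * by simp
  also have "\<dots> = qpoch q q (Suc n) / (\<Prod>i\<in>{0..Suc n} - {k}. q ^ k - q ^ i)"
    unfolding step.IH S by (simp add: qpoch_Suc mult_ac)
  finally show ?case .
qed

lemma inj_power_real: "0 < q \<Longrightarrow> q < (1::real) \<Longrightarrow> inj_on (\<lambda>k. q ^ k) I"
  by (auto simp: inj_on_def power_inject_exp')

text \<open>A balanced \<open>\<^sub>3\<phi>\<^sub>2\<close>. As a function of \<open>q\<^sup>k\<close> the summand without its \<open>q\<close>-binomial weight is
  a polynomial of degree below \<open>n\<close> if \<open>j < n\<close>, and such a polynomial over one linear factor if
  \<open>j = n\<close>; so the \<open>q\<close>-Saalschuetz sum is not needed in full.\<close>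

definition saal_sum :: "real \<Rightarrow> real \<Rightarrow> real \<Rightarrow> nat \<Rightarrow> nat \<Rightarrow> real" where
  "saal_sum q D H n j = (\<Sum>k=0..n. qpoch (1 / q ^ n) q k / qpoch q q k * q ^ k
      * (qpoch (D * q ^ n) q k / qpoch (D * q ^ Suc j) q k) * (qpoch (H * q ^ j) q k / qpoch H q k))"

lemma poly_qpoch: "poly (\<Prod>i<m. [:1, - (c * q ^ i):]) y = qpoch (c * y) q m"
  unfolding poly_prod qpoch_def by (intro prod.cong) (simp_all add: mult_ac)

lemma saal_sum_divdiff:
  assumes q: "0 < q" "q < 1"
  shows "saal_sum q D H n j = qpoch q q n * divdiff (\<lambda>k. q ^ k)
     (\<lambda>k. qpoch (D * q ^ n) q k / qpoch (D * q ^ Suc j) q k * (qpoch (H * q ^ j) q k / qpoch H q k)) {0..n}"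
  unfolding saal_sum_def divdiff_def sum_distrib_left
proof (intro sum.cong refl)
  fix k assume "k \<in> {0..n}"
  then have w: "qpoch (1 / q ^ n) q k / qpoch q q k * q ^ k = qpoch q q n / (\<Prod>i\<in>{0..n} - {k}. q ^ k - q ^ i)"
    using q by (intro q_weight_eq_divdiff_weight) auto
  show "qpoch (1 / q ^ n) q k / qpoch q q k * q ^ k
      * (qpoch (D * q ^ n) q k / qpoch (D * q ^ Suc j) q k) * (qpoch (H * q ^ j) q k / qpoch H q k)
    = qpoch q q n * (qpoch (D * q ^ n) q k / qpoch (D * q ^ Suc j) q k * (qpoch (H * q ^ j) q k / qpoch H q k)
      / (\<Prod>i\<in>{0..n} - {k}. q ^ k - q ^ i))"
    unfolding w by (simp add: mult_ac)
qed

text \<open>Shift and length change places: a quotient of factorials of length k becomes a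
  polynomial of degree m in q^k.\<close>

lemma qpoch_shift_quotient:
  assumes "qpoch x q k \<noteq> 0" "qpoch x q m \<noteq> 0"
  shows "qpoch (x * q ^ m) q k / qpoch x q k = qpoch (x * q ^ k) q m / qpoch x q m"
  using qpoch_swap[of x q m k] assms by (simp add: field_simps)

text \<open>As polynomials in q^k the quotient with D has degree at most n - j - 1 and the one with
  H degree at most j. The total n - 1 is too small for a divided difference over n + 1
  nodes.\<close>

lemma saal_sum_eq_0:
  assumes q: "0 < q" "q < 1" and j: "j < n"
    and D: "\<And>i. D * q ^ Suc i \<noteq> 1" and H: "\<And>i. i < n \<Longrightarrow> H * q ^ i \<noteq> 1"
  shows "saal_sum q D H n j = 0"
proof -
  define m where "m = n - Suc j"
  let ?B = "D * q ^ Suc j"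
  define P where "P = (\<Prod>i<m. [:1, - (?B * q ^ i):]) * (\<Prod>i<j. [:1, - (H * q ^ i):])"
  have n: "n = Suc j + m" using j by (simp add: m_def)
  have Bn: "qpoch ?B q k \<noteq> 0" for k
    using D[of "j + _"] by (intro qpoch_nonzero) (simp add: power_add mult_ac)
  have Hn: "qpoch H q k \<noteq> 0" if "k \<le> n" for k
    using H that by (intro qpoch_nonzero) simp
  have "divdiff (\<lambda>k. q ^ k) (\<lambda>k. qpoch (D * q ^ n) q k / qpoch ?B q k * (qpoch (H * q ^ j) q k / qpoch H q k)) {0..n}
    = divdiff (\<lambda>k. q ^ k) (\<lambda>k. 1 / (qpoch ?B q m * qpoch H q j) * poly P (q ^ k)) {0..n}"
  proof (rule divdiff_cong)
    fix k assume k: "k \<in> {0..n}"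
    have "D * q ^ n = ?B * q ^ m" by (simp add: n power_add)
    then have "qpoch (D * q ^ n) q k / qpoch ?B q k = qpoch (?B * q ^ k) q m / qpoch ?B q m"
      using qpoch_shift_quotient[OF Bn[of k] Bn[of m]] by (simp only:)
    moreover have "qpoch (H * q ^ j) q k / qpoch H q k = qpoch (H * q ^ k) q j / qpoch H q j"
      using j k by (intro qpoch_shift_quotient Hn) auto
    moreover have "poly P (q ^ k) = qpoch (?B * q ^ k) q m * qpoch (H * q ^ k) q j"
      unfolding P_def poly_mult poly_qpoch ..
    ultimately show "qpoch (D * q ^ n) q k / qpoch ?B q k * (qpoch (H * q ^ j) q k / qpoch H q k)
        = 1 / (qpoch ?B q m * qpoch H q j) * poly P (q ^ k)"
      by simp
  qed
  also have "\<dots> = 1 / (qpoch ?B q m * qpoch H q j) * divdiff (\<lambda>k. q ^ k) (\<lambda>k. poly P (q ^ k)) {0..n}"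
    by (rule divdiff_cmult)
  also have "divdiff (\<lambda>k. q ^ k) (\<lambda>k. poly P (q ^ k)) {0..n} = 0"
  proof (rule divdiff_poly)
    have "degree P \<le> m + j" unfolding P_def
      by (rule order_trans[OF degree_mult_le add_mono[OF degree_prod_linear_le degree_prod_linear_le]])
    then show "degree P + 1 < card {0..n}" using n by simp
  qed (use q inj_power_real in auto)
  finally show ?thesis using saal_sum_divdiff[OF q, of D H n j] by simp
qed

text \<open>For j = n the quotient with D telescopes to (1 - D q^n)/(1 - D q^(n+k)). It has a single
  pole in q^k, and the value of the H polynomial at that pole gives the sum.\<close>

lemma saal_sum_diag:
  assumes q: "0 < q" "q < 1" and D0: "D \<noteq> 0"
    and D: "\<And>i. D * q ^ Suc i \<noteq> 1" "n = 0 \<Longrightarrow> D \<noteq> 1" and H: "\<And>i. i < n \<Longrightarrow> H * q ^ i \<noteq> 1"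
  shows "saal_sum q D H n n = qpoch q q n * qpoch (H / (D * q ^ n)) q n * (D * q ^ n) ^ n
           / (qpoch H q n * qpoch (D * q ^ Suc n) q n)"
proof -
  let ?E = "D * q ^ n"
  define P where "P = (\<Prod>i<n. [:1, - (H * q ^ i):])"
  \<comment> \<open>Only for n = k = 0 is the number in question D itself, which explains the
    separate hypothesis for n = 0.\<close>
  have E: "?E * q ^ k \<noteq> 1" for k
    using D(1)[of "n - 1 + k"] D(2) D(1)[of "k - 1"] by (cases n; cases k) (simp_all add: power_add mult_ac)
  have En: "qpoch ?E q k \<noteq> 0" for k
    using E by (intro qpoch_nonzero) simp
  have En': "qpoch (D * q ^ Suc n) q k \<noteq> 0" for k
    using E[of "Suc _"] by (intro qpoch_nonzero) (simp add: mult_ac)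
  have Hn: "qpoch H q k \<noteq> 0" if "k \<le> n" for k
    using H that by (intro qpoch_nonzero) simp
  have "divdiff (\<lambda>k. q ^ k) (\<lambda>k. qpoch ?E q k / qpoch (D * q ^ Suc n) q k * (qpoch (H * q ^ n) q k / qpoch H q k)) {0..n}
    = divdiff (\<lambda>k. q ^ k) (\<lambda>k. ((1 - ?E) / qpoch H q n) * (poly P (q ^ k) / (1 - ?E * q ^ k))) {0..n}"
  proof (rule divdiff_cong)
    fix k assume k: "k \<in> {0..n}"
    have "qpoch ?E q k * (1 - ?E * q ^ k) = (1 - ?E) * qpoch (D * q ^ Suc n) q k"
      using qpoch_Suc[of ?E q k] qpoch_Suc_left[of ?E q k] by (simp add: mult_ac)
    then have "qpoch ?E q k / qpoch (D * q ^ Suc n) q k = (1 - ?E) / (1 - ?E * q ^ k)"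
      using E[of k] En' by (simp add: frac_eq_eq del: power_Suc)
    moreover have "qpoch (H * q ^ n) q k / qpoch H q k = qpoch (H * q ^ k) q n / qpoch H q n"
      using k by (intro qpoch_shift_quotient Hn) auto
    ultimately show "qpoch ?E q k / qpoch (D * q ^ Suc n) q k * (qpoch (H * q ^ n) q k / qpoch H q k)
      = ((1 - ?E) / qpoch H q n) * (poly P (q ^ k) / (1 - ?E * q ^ k))"
      by (simp add: P_def poly_qpoch)
  qed
  also have "\<dots> = (1 - ?E) / qpoch H q n * divdiff (\<lambda>k. q ^ k) (\<lambda>k. poly P (q ^ k) / (1 - ?E * q ^ k)) {0..n}"
    by (rule divdiff_cmult)
  also have "divdiff (\<lambda>k. q ^ k) (\<lambda>k. poly P (q ^ k) / (1 - ?E * q ^ k)) {0..n}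
      = poly P (1 / ?E) * ?E ^ (card {0..n} - 1) / (\<Prod>k\<in>{0..n}. 1 - ?E * q ^ k)"
    using q D0 E degree_prod_linear_le[of "\<lambda>_. 1" "\<lambda>i. - (H * q ^ i)" n]
    by (intro divdiff_poly_over_linear inj_power_real) (auto simp: P_def)
  also have "(\<Prod>k\<in>{0..n}. 1 - ?E * q ^ k) = (1 - ?E) * qpoch (D * q ^ Suc n) q n"
    using qpoch_Suc_left[of ?E q n]
    by (simp add: qpoch_def atLeast0AtMost lessThan_Suc_atMost mult_ac)
  also have "poly P (1 / ?E) = qpoch (H / ?E) q n"
    by (simp add: P_def poly_qpoch)
  finally show ?thesis unfolding saal_sum_divdiff[OF q, of D H n n]
    using E[of 0] by simp
qed

text \<open>Found by completing the shift of H: (H; q)_s (H q^s; q)_j = (H; q)_j (H q^j; q)_s. The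
  lattice is invariant under q^s -> 1/(C q^s), so a polynomial in x must contain the mirror image
  (H/(C q^s); q)_j as well.\<close>

definition psi_poly :: "real \<Rightarrow> real \<Rightarrow> real \<Rightarrow> nat \<Rightarrow> real poly" where
  "psi_poly q C H j = (\<Prod>i<j. [:1 + H\<^sup>2 * q ^ (i + i) / C, - (H * q ^ i / C):])"

lemma poly_psi:
  assumes "q \<noteq> 0" "C \<noteq> 0"
  shows "poly (psi_poly q C H j) (qlat q C s) = qpoch (H * q ^ s) q j * qpoch (H / C / q ^ s) q j"
  using assms unfolding psi_poly_def poly_prod qpoch_def prod.distrib[symmetric]
  by (intro prod.cong) (simp_all add: qlat_def field_simps power_add power2_eq_square)

text \<open>For y = H/C, where q/y is \<open>A * e\<close>, the mirror factor of
  \<open>psi_poly\<close> becomes a shift of \<open>A * e\<close>. The power q^(j s) left over is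
  what turns e^s into (e/q^j)^s.\<close>

lemma qpoch_shift_down:
  assumes "y \<noteq> 0" "q \<noteq> 0"
  shows "qpoch y q j * qpoch (q / y) q s = q ^ (j * s) * qpoch (q / y / q ^ j) q s * qpoch (y / q ^ s) q j"
proof -
  have 1: "qpoch (y / q ^ s) q s = (\<Prod>i<s. - y / q ^ Suc i) * qpoch (q / y) q s"
    using qpoch_reverse[of "1 / y" q s] assms by (simp add: mult.commute)
  have "qpoch (y / q ^ s * q ^ j) q s = (\<Prod>i<s. - y / q ^ Suc i * q ^ j) * qpoch (q / y / q ^ j) q s"
    using qpoch_reverse[of "1 / (y * q ^ j)" q s] assms by (simp add: mult_ac)
  then have 2: "qpoch (y / q ^ s * q ^ j) q s
      = (\<Prod>i<s. - y / q ^ Suc i) * (q ^ (j * s) * qpoch (q / y / q ^ j) q s)"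
    unfolding prod.distrib by (simp add: power_mult)
  have "qpoch (y / q ^ s) q s * qpoch y q j = qpoch (y / q ^ s) q j * qpoch (y / q ^ s * q ^ j) q s"
    using qpoch_swap[of "y / q ^ s" q s j] assms by simp
  then have "(\<Prod>i<s. - y / q ^ Suc i) * (qpoch (q / y) q s * qpoch y q j)
      = (\<Prod>i<s. - y / q ^ Suc i) * (q ^ (j * s) * qpoch (q / y / q ^ j) q s * qpoch (y / q ^ s) q j)"
    unfolding 1 2 by (simp only: mult_ac)
  moreover have "(\<Prod>i<s. - y / q ^ Suc i) \<noteq> 0" using assms by simp
  ultimately have "qpoch (q / y) q s * qpoch y q j
      = q ^ (j * s) * qpoch (q / y / q ^ j) q s * qpoch (y / q ^ s) q j"
    by (metis mult_left_cancel)
  then show ?thesis by (simp only: mult.commute)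
qed

lemma vwp_shift:
  assumes q: "q \<noteq> 0" and C: "C * q = A * H * e" and nz: "C \<noteq> 0" "H \<noteq> 0"
    and Ae: "qpoch (A * e) q s \<noteq> 0" "qpoch (A * (e / q ^ j)) q s \<noteq> 0"
  shows "vwp q A H e s * poly (psi_poly q C H j) (qlat q C s)
     = qpoch H q j * qpoch (H / C) q j * vwp q A (H * q ^ j) (e / q ^ j) s"
proof -
  have Ae': "q / (H / C) = A * e" using C nz by (simp add: field_simps)
  have 1: "qpoch H q s * qpoch (H * q ^ s) q j = qpoch H q j * qpoch (H * q ^ j) q s"
    by (rule qpoch_swap)
  have 2: "qpoch (H / C) q j * qpoch (A * e) q s
     = q ^ (j * s) * qpoch (A * (e / q ^ j)) q s * qpoch (H / C / q ^ s) q j"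
    using qpoch_shift_down[of "H / C" q j s] nz q unfolding Ae' by simp
  have "vwp q A H e s * poly (psi_poly q C H j) (qlat q C s)
     = qpoch A q s * (qpoch H q s * qpoch (H * q ^ s) q j) / qpoch (H * e) q s * e ^ s
       * (qpoch (H / C / q ^ s) q j / qpoch (A * e) q s)"
    unfolding poly_psi[OF q nz(1)] vwp_def by simp
  also have "qpoch (H / C / q ^ s) q j / qpoch (A * e) q s
     = qpoch (H / C) q j / (q ^ (j * s) * qpoch (A * (e / q ^ j)) q s)"
    using 2 Ae q by (simp add: frac_eq_eq mult_ac)
  finally show ?thesis unfolding 1 vwp_def
    using q by (simp add: power_divide power_mult mult_ac)
qed

section \<open>Orthogonality for generic parameters\<close>

lemma prod_remove_split:
  fixes f :: "nat \<Rightarrow> real"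
  shows "(\<Prod>i\<in>{0..s + M} - {s}. f i) = (\<Prod>i<s. f i) * (\<Prod>j<M. f (Suc (s + j)))"
proof (induction M)
  case 0
  have "{0..s + 0} - {s} = {..<s}" by auto
  then show ?case by simp
next
  case (Suc M)
  have "{0..s + Suc M} - {s} = insert (Suc (s + M)) ({0..s + M} - {s})" by auto
  then show ?case using Suc by (simp add: mult_ac)
qed

lemma prod_qlat_diff:
  assumes "q \<noteq> 0"
  shows "(\<Prod>i\<in>{0..s + M} - {s}. qlat q C s - qlat q C i)
     = qpoch q q s * qpoch q q M * (\<Prod>i<M. - 1 / q ^ Suc i) / q ^ (s * (s + M))
       * (\<Prod>i\<in>{0..s + M} - {s}. 1 - C * q ^ (s + i))"
proof -
  have "(\<Prod>i<s. qlat q C s - qlat q C i) = (\<Prod>i<s. (1 - q ^ (s - i)) * (1 / q ^ s) * (1 - C * q ^ (s + i)))"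
  proof (intro prod.cong refl)
    fix i assume "i \<in> {..<s}"
    then show "qlat q C s - qlat q C i = (1 - q ^ (s - i)) * (1 / q ^ s) * (1 - C * q ^ (s + i))"
      using qlat_diff[OF assms, of C i "s - i"] by (simp add: add.commute)
  qed
  also have "\<dots> = (\<Prod>i<s. 1 - q ^ (s - i)) * (\<Prod>i<s. 1 / q ^ s) * (\<Prod>i<s. 1 - C * q ^ (s + i))"
    by (simp only: prod.distrib)
  also have "(\<Prod>i<s. 1 / q ^ s) = 1 / q ^ (s * s)"
    by (simp add: power_mult power_divide)
  finally have 1: "(\<Prod>i<s. qlat q C s - qlat q C i)
      = qpoch q q s * (1 / q ^ (s * s)) * (\<Prod>i<s. 1 - C * q ^ (s + i))"
    unfolding prod_one_minus_power_rev .
  have "(\<Prod>j<M. qlat q C s - qlat q C (Suc (s + j)))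
      = (\<Prod>j<M. (1 - q * q ^ j) * (- 1 / q ^ Suc j) * (1 / q ^ s) * (1 - C * q ^ (s + Suc (s + j))))"
  proof (intro prod.cong refl)
    fix j assume "j \<in> {..<M}"
    have "qlat q C s - qlat q C (Suc (s + j)) = - (qlat q C (s + Suc j) - qlat q C s)" by simp
    also have "\<dots> = (1 - q * q ^ j) * (- 1 / q ^ Suc j) * (1 / q ^ s) * (1 - C * q ^ (s + Suc (s + j)))"
      unfolding qlat_diff[OF assms] by (simp add: power_add mult_ac)
    finally show "qlat q C s - qlat q C (Suc (s + j)) = \<dots>" .
  qed
  also have "\<dots> = (\<Prod>j<M. 1 - q * q ^ j) * (\<Prod>j<M. - 1 / q ^ Suc j) * (\<Prod>j<M. 1 / q ^ s)
      * (\<Prod>j<M. 1 - C * q ^ (s + Suc (s + j)))"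
    by (simp only: prod.distrib)
  also have "(\<Prod>j<M. 1 / q ^ s) = 1 / q ^ (s * M)"
    by (simp add: power_mult power_divide)
  finally have 2: "(\<Prod>j<M. qlat q C s - qlat q C (Suc (s + j))) = qpoch q q M
      * (\<Prod>j<M. - 1 / q ^ Suc j) * (1 / q ^ (s * M)) * (\<Prod>j<M. 1 - C * q ^ (s + Suc (s + j)))"
    unfolding qpoch_def .
  show ?thesis unfolding prod_remove_split 1 2
    by (simp add: power_add distrib_left)
qed

text \<open>Meant for X = D, giving e, and X = t, giving A e. Both produce the same power q^(N n),
  which drops out of the quotient of total masses.\<close>

lemma qpoch_reverse_shift:
  assumes "X \<noteq> 0" "q \<noteq> 0"
  shows "qpoch (1 / (X * q ^ N) / q ^ n) q N * qpoch (X * q) q n * q ^ (N * n)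
     = qpoch (1 / (X * q ^ N)) q N * qpoch (X * q * q ^ N) q n"
proof -
  let ?e = "1 / (X * q ^ N)"
  have 1: "qpoch (?e / q ^ n) q n * qpoch ?e q N = qpoch (?e / q ^ n) q N * qpoch (?e / q ^ n * q ^ N) q n"
    using qpoch_swap[of "?e / q ^ n" q n N] assms by simp
  have 2: "qpoch (?e / q ^ n) q n = (\<Prod>i<n. - 1 / (X * q ^ Suc i) * (1 / q ^ N)) * qpoch (X * q * q ^ N) q n"
    using qpoch_reverse[of "X * q ^ N" q n] assms by (simp add: mult_ac)
  have 3: "qpoch (?e / q ^ n * q ^ N) q n = (\<Prod>i<n. - 1 / (X * q ^ Suc i)) * qpoch (X * q) q n"
    using qpoch_reverse[of X q n] assms by simp
  have P: "(\<Prod>i<n. - 1 / (X * q ^ Suc i)) \<noteq> 0" using assms by simp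
  have "(\<Prod>i<n. - 1 / (X * q ^ Suc i) * (1 / q ^ N)) = (\<Prod>i<n. - 1 / (X * q ^ Suc i)) * (1 / q ^ (N * n))"
    unfolding prod.distrib by (simp add: power_mult power_divide)
  from 1[unfolded 2 3 this] have "(\<Prod>i<n. - 1 / (X * q ^ Suc i)) * (1 / q ^ (N * n) * qpoch (X * q * q ^ N) q n * qpoch ?e q N)
    = (\<Prod>i<n. - 1 / (X * q ^ Suc i)) * (qpoch (?e / q ^ n) q N * qpoch (X * q) q n)"
    by (simp only: mult_ac)
  with P have "1 / q ^ (N * n) * qpoch (X * q * q ^ N) q n * qpoch ?e q N
     = qpoch (?e / q ^ n) q N * qpoch (X * q) q n"
    by (metis mult_left_cancel)
  then show ?thesis using assms by (simp add: field_simps)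
qed

text \<open>The common closed form of both weights, with \<open>t = q\<^sup>\<alpha>\<close> for the \<open>q\<close>-Racah and \<open>t = 0\<close> for the
  dual \<open>q\<close>-Hahn weight. Leaving out the index \<open>i = s\<close> is the cancellation against \<open>[2s + 2a + 1]\<^sub>q\<close> or
  \<open>\<Delta>x(s - 1/2)\<close>, so no removable singularity is left.\<close>

definition racah_wt :: "real \<Rightarrow> real \<Rightarrow> real \<Rightarrow> real \<Rightarrow> nat \<Rightarrow> nat \<Rightarrow> real" where
  "racah_wt q g d t N s =
     (g * q) ^ (N - s) * qpoch q q N / (qpoch q q s * qpoch q q (N - s))
     * (qpoch (g * q) q s * qpoch (t * g * d * q ^ (N + 2)) q s * qpoch (t * q) q (N - s)
        * qpoch (d * q * q ^ s) q (N - s))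
     / (qpoch (t * g * q\<^sup>2) q N * (\<Prod>i\<in>{0..N} - {s}. 1 - g * d * q * q ^ (s + i)))"

locale racah_parameters =
  fixes q g d t :: real and N :: nat
  assumes q: "0 < q" "q < 1" and pos: "0 < g" "0 < d" "0 < t"
    and small: "t < 1" "t * g < 1" "t * g * d < 1"
    and gne: "\<And>i. i < N \<Longrightarrow> g * q * q ^ i \<noteq> 1" and dne: "\<And>i. i < N \<Longrightarrow> d * q * q ^ i \<noteq> 1"
    and gdne: "\<And>i j. i < j \<Longrightarrow> j \<le> N \<Longrightarrow> g * d * q * q ^ (i + j) \<noteq> 1"
begin

text \<open>In the original parameters A, C, D, H are q^(\<beta>+1), q^(2a+1),
  q^(\<alpha>+\<beta>+1), q^(a+b+\<alpha>+1), and e is the value forced by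
  \<open>C * q = A * H * e\<close>.\<close>

abbreviation "A \<equiv> g * q"
abbreviation "C \<equiv> g * d * q"
abbreviation "D \<equiv> t * g * q"
abbreviation "H \<equiv> t * g * d * q ^ (N + 2)"
abbreviation "e \<equiv> 1 / (D * q ^ N)"

lemma nonzero: "q \<noteq> 0" "g \<noteq> 0" "d \<noteq> 0" "t \<noteq> 0"
  using q pos by auto

lemma CAHe: "C * q = A * H * e"
  using nonzero by (simp add: field_simps power_add power2_eq_square)

lemma CAHe': "C * q = A * (H * q ^ j) * (e / q ^ j)"
  using CAHe nonzero by simp

lemma He: "H * e = d * q"
  using nonzero by (simp add: field_simps power_add power2_eq_square)

lemma He': "H * q ^ j * (e / q ^ j) = d * q"
  using He nonzero by simp

lemma Ae: "A * e = 1 / (t * q ^ N)"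
  using nonzero by (simp add: field_simps)

lemma less_one_power: "x < 1 \<Longrightarrow> 0 < x \<Longrightarrow> x * q ^ i < 1"
proof -
  assume x: "x < 1" "0 < x"
  have "x * q ^ i \<le> x * 1" using q x by (intro mult_left_mono power_le_one) auto
  then show ?thesis using x by linarith
qed

lemma H_ne: "H * q ^ i \<noteq> 1"
  using less_one_power[of "t * g * d" "N + 2 + i"] small pos by (simp add: power_add mult.assoc)

lemma D_ne: "D * q ^ i \<noteq> 1"
  using less_one_power[of "t * g" "Suc i"] small pos by (simp add: mult.assoc)

lemma Ae_ne: "i < N \<Longrightarrow> A * (e / q ^ j) * q ^ i \<noteq> 1"
  using less_one_power[of t "N + j - i"] small pos nonzero
  by (auto simp: field_simps power_add[symmetric] power_diff)

lemma e_ne: "i < N \<Longrightarrow> e / q ^ j * q ^ i \<noteq> 1"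
  using less_one_power[of "t * g" "Suc (N + j - i)"] small pos nonzero
  by (auto simp: field_simps power_add[symmetric] power_diff)

lemma q_ne: "q * q ^ i \<noteq> 1"
  using less_one_power[of q i] q by simp

lemma t_ne: "t * q * q ^ j * q ^ i \<noteq> 1"
  using less_one_power[of t "Suc (j + i)"] small pos by (simp add: power_add mult.assoc)

lemma qpoch_Ae_ne: "k \<le> N \<Longrightarrow> qpoch (A * (e / q ^ j)) q k \<noteq> 0"
  by (rule qpoch_nonzero, rule Ae_ne) simp

lemma inj_x: "inj_on (qlat q C) {0..N}"
  using q gdne by (intro inj_on_qlat)

text \<open>Total mass of the weight with parameters shifted by j. Because \<open>H * e\<close> is
  invariant, j enters its closed form through e and A e only.\<close>

definition mass where "mass j = divdiff (qlat q C) (vwp q A (H * q ^ j) (e / q ^ j)) {0..N}"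

lemma mass_eq: "mass j = (\<Prod>i<N. - (q ^ Suc i)) * qpoch (e / q ^ j) q N
     / (qpoch q q N * qpoch (d * q) q N * qpoch (A * (e / q ^ j)) q N)"
proof -
  have "divdiff (qlat q C) (vwp q A (H * q ^ j) (e / q ^ j)) {0..0 + N}
     = vwp q A (H * q ^ j) (e / q ^ j) 0 * (\<Prod>i<N. - (q ^ (0 + i + 1))) * qpoch (e / q ^ j) q N
      / (qpoch q q N * qpoch (H * q ^ j * (e / q ^ j) * q ^ 0) q N * qpoch (A * (e / q ^ j) * q ^ 0) q N)"
    by (rule divdiff_vwp[OF q CAHe'[of j]]) (use He' dne Ae_ne inj_x in auto)
  then show ?thesis unfolding mass_def He' by (simp add: vwp_def)
qed

lemma mass_nonzero: "mass 0 \<noteq> 0"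
  unfolding mass_eq using nonzero q_ne dne Ae_ne[of _ 0] e_ne[of _ 0]
  by (auto intro!: qpoch_nonzero)

lemma mass_shift: "mass n * (qpoch (D * q) q n * qpoch (t * q * q ^ N) q n)
    = mass 0 * (qpoch (D * q * q ^ N) q n * qpoch (t * q) q n)"
proof -
  have 1: "qpoch (e / q ^ n) q N * qpoch (D * q) q n * q ^ (N * n) = qpoch e q N * qpoch (D * q * q ^ N) q n"
    using qpoch_reverse_shift[of D q N n] nonzero by simp
  have 2: "qpoch (A * (e / q ^ n)) q N * qpoch (t * q) q n * q ^ (N * n)
      = qpoch (A * e) q N * qpoch (t * q * q ^ N) q n"
    using qpoch_reverse_shift[of t q N n] nonzero Ae by (simp add: mult_ac)
  have nz: "qpoch (A * (e / q ^ n)) q N \<noteq> 0" "qpoch (A * e) q N \<noteq> 0"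
     "q ^ (N * n) \<noteq> 0"
    using Ae_ne[of _ n] Ae_ne[of _ 0] nonzero by (auto intro!: qpoch_nonzero)
  have gen: "P * a / (Q * b) * (x * y) = P * c / (Q * f) * (z * w)"
    if "a * x * r = c * z" "b * w * r = f * y" "b \<noteq> 0" "f \<noteq> 0" "r \<noteq> 0" for a b c f x y z w r P Q :: real
  proof -
    have "r * (a * x * y * f) = r * (c * z * w * b)" using that(1,2) by algebra
    then have "a * x * y * f = c * z * w * b" using that by simp
    then have "a * (x * y) / b = c * (z * w) / f" using that by (simp add: frac_eq_eq mult_ac)
    then show ?thesis by (metis (no_types, opaque_lifting) mult.assoc times_divide_eq_left times_divide_times_eq)
  qed
  show ?thesis
    unfolding mass_eq using gen[OF 1 2 nz] by simp
qed

definition U_coeff where "U_coeff n k = qpoch (1 / q ^ n) q k * qpoch (D * q ^ n) q k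
     / (qpoch (1 / q ^ N) q k * qpoch A q k * qpoch H q k * qpoch q q k) * q ^ k"

text \<open>The 4phi3 series as a polynomial in x, still without its prefactor; a polynomial is
  needed here because the argument compares leading coefficients.\<close>

definition U where "U n = (\<Sum>k=0..n. smult (U_coeff n k) (phi_poly q C k))"

definition L where "L p = divdiff (qlat q C) (\<lambda>s. vwp q A H e s * poly p (qlat q C s)) {0..N}"

lemma L_add: "L (p + r) = L p + L r"
  unfolding L_def by (simp add: distrib_left divdiff_add)

lemma L_smult: "L (smult a p) = a * L p"
  unfolding L_def by (subst divdiff_cmult[symmetric]) (simp add: mult_ac)

lemma qN_ne: "k \<le> N \<Longrightarrow> qpoch (1 / q ^ N) q k \<noteq> 0"
  using q by (rule qpoch_neg_power_nonzero)

lemma A_ne: "k \<le> N \<Longrightarrow> qpoch A q k \<noteq> 0"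
  using gne by (intro qpoch_nonzero) simp

text \<open>After the shift by \<open>\<psi>\<^sub>j\<close> the k-th basis term contributes (A, H
  q^j, q^-N; q)_k / (D q^(j+1); q)_k. The factors with A and q^-N cancel against the coefficients of
  the series, and what remains is balanced.\<close>

lemma L_U_psi:
  assumes "n \<le> N"
  shows "L (U n * psi_poly q C H j) = qpoch H q j * qpoch (H / C) q j * mass j * saal_sum q D H n j"
proof -
  let ?x = "qlat q C"
  let ?b = "qpoch H q j * qpoch (H / C) q j"
  have "L (U n * psi_poly q C H j) = divdiff ?x (\<lambda>s. \<Sum>k\<in>{0..n}. (?b * U_coeff n k)
      * (poly (phi_poly q C k) (?x s) * vwp q A (H * q ^ j) (e / q ^ j) s)) {0..N}"
    unfolding L_def
  proof (rule divdiff_cong)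
    fix s assume s: "s \<in> {0..N}"
    have "vwp q A H e s * poly (psi_poly q C H j) (?x s) = ?b * vwp q A (H * q ^ j) (e / q ^ j) s"
    proof (rule vwp_shift[OF nonzero(1) CAHe])
      show "qpoch (A * e) q s \<noteq> 0" "qpoch (A * (e / q ^ j)) q s \<noteq> 0"
        using qpoch_Ae_ne[of s 0] qpoch_Ae_ne[of s j] s by simp_all
    qed (use nonzero in auto)
    then have "vwp q A H e s * poly (U n * psi_poly q C H j) (?x s)
      = (\<Sum>k\<in>{0..n}. U_coeff n k * poly (phi_poly q C k) (?x s)) * (?b * vwp q A (H * q ^ j) (e / q ^ j) s)"
      by (simp add: U_def poly_sum mult.left_commute)
    then show "vwp q A H e s * poly (U n * psi_poly q C H j) (?x s)
      = (\<Sum>k\<in>{0..n}. (?b * U_coeff n k) * (poly (phi_poly q C k) (?x s) * vwp q A (H * q ^ j) (e / q ^ j) s))"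
      unfolding sum_distrib_right by (simp only: mult_ac)
  qed
  also have "\<dots> = (\<Sum>k\<in>{0..n}. (?b * U_coeff n k)
      * divdiff ?x (\<lambda>s. poly (phi_poly q C k) (?x s) * vwp q A (H * q ^ j) (e / q ^ j) s) {0..N})"
    by (simp only: divdiff_sum divdiff_cmult)
  also have "\<dots> = (\<Sum>k\<in>{0..n}. ?b * mass j * (qpoch (1 / q ^ n) q k / qpoch q q k * q ^ k
      * (qpoch (D * q ^ n) q k / qpoch (D * q ^ Suc j) q k) * (qpoch (H * q ^ j) q k / qpoch H q k)))"
  proof (rule sum.cong)
    fix k assume "k \<in> {0..n}"
    then have k: "k \<le> N" using assms by simp
    have "divdiff ?x (\<lambda>s. poly (phi_poly q C k) (?x s) * vwp q A (H * q ^ j) (e / q ^ j) s) {0..N}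
      = mass j * (qpoch A q k * qpoch (H * q ^ j) q k * qpoch (1 / q ^ N) q k / qpoch (q / (e / q ^ j * q ^ N)) q k)"
      unfolding mass_def
      by (rule divdiff_phi_vwp[OF q CAHe'[of j]]) (use nonzero He' dne Ae_ne e_ne inj_x k in auto)
    also have "q / (e / q ^ j * q ^ N) = D * q ^ Suc j" using nonzero by (simp add: field_simps)
    finally have 1: "divdiff ?x (\<lambda>s. poly (phi_poly q C k) (?x s) * vwp q A (H * q ^ j) (e / q ^ j) s) {0..N}
      = mass j * (qpoch A q k * qpoch (H * q ^ j) q k * qpoch (1 / q ^ N) q k / qpoch (D * q ^ Suc j) q k)" .
    have gen: "(b * (n1 * n2 / (x * y * h * z) * w)) * (K * (y * hj * x / p)) = b * K * (n1 / z * w * (n2 / p) * (hj / h))"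
      if "x \<noteq> 0" "y \<noteq> 0" for b n1 n2 x y h z w K hj p :: real using that by (simp add: mult_ac)
    show "?b * U_coeff n k * divdiff ?x (\<lambda>s. poly (phi_poly q C k) (?x s) * vwp q A (H * q ^ j) (e / q ^ j) s) {0..N}
      = ?b * mass j * (qpoch (1 / q ^ n) q k / qpoch q q k * q ^ k
      * (qpoch (D * q ^ n) q k / qpoch (D * q ^ Suc j) q k) * (qpoch (H * q ^ j) q k / qpoch H q k))"
      unfolding 1 U_coeff_def by (rule gen) (use qN_ne A_ne k in auto)
  qed simp
  also have "\<dots> = ?b * mass j * saal_sum q D H n j"
    unfolding saal_sum_def sum_distrib_left ..
  finally show ?thesis .
qed

lemma coeff_U: "coeff (U n) n = U_coeff n n * (\<Prod>i<n. - (q ^ i))" "n < m \<Longrightarrow> coeff (U n) m = 0"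
proof -
  have "coeff (U n) n = (\<Sum>k\<in>{0..n}. if k = n then U_coeff n n * (\<Prod>i<n. - (q ^ i)) else 0)"
    unfolding U_def coeff_sum
    by (intro sum.cong) (auto simp: phi_poly_def coeff_prod_linear coeff_prod_linear_eq_0)
  then show "coeff (U n) n = U_coeff n n * (\<Prod>i<n. - (q ^ i))" by simp
  assume "n < m"
  then show "coeff (U n) m = 0"
    unfolding U_def coeff_sum by (intro sum.neutral) (auto simp: phi_poly_def coeff_prod_linear_eq_0)
qed

text \<open>Orthogonality to the lower members of the second basis leaves only the coefficient of
  index n. Taking p of degree at most n covers p = U m for m < n and for m = n alike.\<close>

lemma L_U:
  assumes n: "n \<le> N" and p: "\<And>i. n < i \<Longrightarrow> coeff p i = 0"
  shows "L (U n * p) = coeff p n / (\<Prod>i<n. - (H * q ^ i / C))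
     * (qpoch H q n * qpoch (H / C) q n * mass n * saal_sum q D H n n)"
proof -
  have "L (U n * p) = coeff p n / coeff (psi_poly q C H n) n * L (U n * psi_poly q C H n)"
  proof (rule linear_functional_leading_coeff[of "\<lambda>p. L (U n * p)"])
    show "L (U n * psi_poly q C H i) = 0" if "i < n" for i
      using L_U_psi[OF n, of i] saal_sum_eq_0[OF q that, of D H] D_ne[of "Suc _"] H_ne by simp
    show "coeff (psi_poly q C H i) i \<noteq> 0" for i
      using nonzero by (simp add: psi_poly_def coeff_prod_linear)
  qed (use p in \<open>simp_all add: distrib_left L_add L_smult psi_poly_def coeff_prod_linear_eq_0\<close>)
  then show ?thesis unfolding L_U_psi[OF n] by (simp add: psi_poly_def coeff_prod_linear)
qed

definition U_norm where "U_norm n = (g * d * q) ^ n * (qpoch q q n * qpoch (D * q ^ n) q n * qpoch (D * q * q ^ N) q n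
      * qpoch (t * q) q n * qpoch (1 / (d * q ^ N)) q n)
     / (qpoch (1 / q ^ N) q n * qpoch A q n * qpoch H q n * qpoch (D * q) q (n + n))"

lemma L_U_U:
  assumes "n \<le> N" "m \<le> N"
  shows "L (U n * U m) = (if n = m then mass 0 * U_norm n else 0)"
proof -
  have off: "L (U n * U m) = 0" if "m < n" "n \<le> N" for n m
    using L_U[OF that(2), of "U m"] coeff_U(2) that by simp
  have "L (U n * U n) = mass 0 * U_norm n"
  proof -
    have nz: "qpoch (t * q * q ^ N) q n \<noteq> 0" "qpoch (D * q) q n \<noteq> 0" "qpoch (D * q ^ Suc n) q n \<noteq> 0"
      "qpoch H q n \<noteq> 0" "qpoch (1 / q ^ N) q n \<noteq> 0" "qpoch A q n \<noteq> 0" "qpoch q q n \<noteq> 0"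
      using t_ne D_ne[of "Suc _"] D_ne[of "Suc n + _"] H_ne q_ne qN_ne[OF assms(1)] A_ne[OF assms(1)]
      by (simp_all add: qpoch_nonzero power_add mult.assoc)
    have HC: "H / C = t * q * q ^ N" using nonzero by (simp add: field_simps power_add power2_eq_square)
    \<comment> \<open>The leading coefficients of the two bases; factor by factor their quotient is
      C/H.\<close>
    have ratio: "(\<Prod>i<n. - (q ^ i)) / (\<Prod>i<n. - (H * q ^ i / C)) = (1 / (t * q * q ^ N)) ^ n"
      using HC nonzero by (simp flip: prod_dividef) (simp add: field_simps)
    have S: "saal_sum q D H n n = qpoch q q n * qpoch (H / (D * q ^ n)) q n * (D * q ^ n) ^ n
           / (qpoch H q n * qpoch (D * q ^ Suc n) q n)"
      using D_ne[of 0] D_ne[of "Suc _"] H_ne nonzero by (intro saal_sum_diag[OF q]) auto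
    have r1: "qpoch (H / (D * q ^ n)) q n = (\<Prod>i<n. - (d * q * q ^ N) / q ^ Suc i) * qpoch (1 / (d * q ^ N)) q n"
    proof -
      have "H / (D * q ^ n) = 1 / (1 / (d * q * q ^ N) * q ^ n)"
        using nonzero by (simp add: field_simps power_add power2_eq_square)
      then show ?thesis using qpoch_reverse[of "1 / (d * q * q ^ N)" q n] nonzero by (simp add: mult_ac)
    qed
    have r2: "qpoch (1 / q ^ n) q n = (\<Prod>i<n. - 1 / q ^ Suc i) * qpoch q q n"
      using qpoch_reverse[of 1 q n] nonzero by simp
    \<comment> \<open>All pure powers are collected here: two from reversals, q^n from the last term
      of the series, one from the leading coefficients, one from the balanced sum. The powers
      q^(n^2) and t^n cancel, which leaves the factor of the norm.\<close>
    have pw: "(\<Prod>i<n. - 1 / q ^ Suc i) * (\<Prod>i<n. - (d * q * q ^ N) / q ^ Suc i) * q ^ n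
        * (1 / (t * q * q ^ N)) ^ n * (D * q ^ n) ^ n = (g * d * q) ^ n"
    proof -
      have "(\<Prod>i<n. q ^ i) * (\<Prod>i<n. q ^ i) * q ^ n = (q ^ n) ^ n"
      proof (induction n)
        case (Suc n)
        have "(\<Prod>i<Suc n. q ^ i) * (\<Prod>i<Suc n. q ^ i) * q ^ Suc n
          = ((\<Prod>i<n. q ^ i) * (\<Prod>i<n. q ^ i) * q ^ n) * q ^ n * q ^ Suc n" by (simp add: mult_ac)
        then show ?case unfolding Suc by (simp add: power_mult[symmetric] power_add[symmetric] algebra_simps)
      qed simp
      then have "(\<Prod>i<n. q ^ i * q ^ i * q) = (q ^ n) ^ n"
        by (simp add: prod.distrib)
      then have pn: "(\<Prod>i<n. q ^ i * q ^ i * q * q) = (q ^ n) ^ n * q ^ n"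
        by (simp add: prod.distrib)
      have "(\<Prod>i<n. - 1 / q ^ Suc i) * (\<Prod>i<n. - (d * q * q ^ N) / q ^ Suc i)
         = (\<Prod>i<n. d * q * q ^ N / (q ^ i * q ^ i * q * q))"
        unfolding prod.distrib[symmetric] by (intro prod.cong) (simp_all add: mult_ac)
      also have "\<dots> = (d * q * q ^ N) ^ n / ((q ^ n) ^ n * q ^ n)"
        unfolding prod_dividef pn by simp
      finally show ?thesis using nonzero by (simp add: field_simps power_mult_distrib)
    qed
    have split: "qpoch (D * q) q (n + n) = qpoch (D * q) q n * qpoch (D * q ^ Suc n) q n"
      by (simp add: qpoch_add mult_ac)
    define P1 where "P1 = (\<Prod>i<n. - 1 / q ^ Suc i)"
    define P2 where "P2 = (\<Prod>i<n. - (d * q * q ^ N) / q ^ Suc i)"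
    have "L (U n * U n) = U_coeff n n * ((\<Prod>i<n. - (q ^ i)) / (\<Prod>i<n. - (H * q ^ i / C)))
      * (qpoch H q n * qpoch (t * q * q ^ N) q n * mass n * saal_sum q D H n n)"
      using L_U[OF assms(1), of "U n"] coeff_U unfolding HC by simp
    also have "\<dots> = mass 0 * U_norm n"
    proof -
      have Kn: "mass n = mass 0 * (qpoch (D * q * q ^ N) q n * qpoch (t * q) q n) / (qpoch (D * q) q n * qpoch (t * q * q ^ N) q n)"
        using mass_shift[of n] nz by (simp add: field_simps)
      have gen: "P1 * a * b / (x1 * x2 * x3 * a) * w * r * (x3 * y * (K * (u * v) / (z * y)) * (a * (P2 * f) * l / (x3 * o')))
         = K * ((P1 * P2 * w * r * l) * (a * b * u * v * f) / (x1 * x2 * x3 * (z * o')))"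
        if "a \<noteq> 0" "x3 \<noteq> 0" "y \<noteq> 0" for P1 P2 a b x1 x2 x3 w r y K u v z f l o' :: real
        using that by (simp add: mult_ac)
      show ?thesis
        unfolding ratio U_coeff_def S r1 r2 Kn U_norm_def split pw[symmetric] P1_def[symmetric] P2_def[symmetric]
        by (rule gen) (use nz in auto)
    qed
    finally show ?thesis .
  qed
  moreover have "L (U n * U m) = L (U m * U n)" by (simp only: mult.commute)
  ultimately show ?thesis
    using off[of m n] off[of n m] assms
    by (cases n m rule: linorder_cases) auto
qed

text \<open>Identifies the weight as the divided-difference weight normalised to total mass 1. The
  part of (A e; q)_N beyond s is reversed into (t q; q)_(N-s), and (e; q)_N into (D q; q)_N.\<close>

lemma racah_wt_eq:
  assumes "s \<le> N"
  shows "racah_wt q g d t N s = vwp q A H e s / (\<Prod>i\<in>{0..N} - {s}. qlat q C s - qlat q C i) / mass 0"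
proof -
  obtain M where N: "N = s + M" using assms le_Suc_ex by blast
  let ?P = "\<lambda>m. \<Prod>i<m. - 1 / q ^ Suc i"
  have P: "(\<Prod>i<m. - 1 / (x * q ^ Suc i)) = ?P m / x ^ m" for x m
  proof -
    have "(\<Prod>i<m. - 1 / (x * q ^ Suc i)) = (\<Prod>i<m. - 1 / q ^ Suc i * (1 / x))"
      by (intro prod.cong) (simp_all add: mult_ac)
    then show ?thesis by (simp only: prod.distrib prod_constant) (simp add: power_divide)
  qed
  have P0: "?P m \<noteq> 0" for m using nonzero by simp
  have r1: "qpoch (A * e) q N = qpoch (A * e) q s * (?P M / t ^ M * qpoch (t * q) q M)"
  proof -
    have "A * e * q ^ s = 1 / (t * q ^ M)" unfolding Ae using nonzero by (simp add: N power_add)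
    then show ?thesis using qpoch_add[of "A * e" q s M] qpoch_reverse[of t q M] nonzero P[of t M] by (simp add: N)
  qed
  have r2: "qpoch e q N = ?P N / D ^ N * qpoch (D * q) q N"
    using qpoch_reverse[of D q N] nonzero P[of D N] by simp
  have r3: "qpoch (d * q) q N = qpoch (d * q) q s * qpoch (d * q * q ^ s) q M"
    by (simp add: N qpoch_add)
  have "(\<Prod>i<N. - (q ^ Suc i)) * ?P N = (\<Prod>i<N. 1)"
    unfolding prod.distrib[symmetric] using nonzero by (intro prod.cong) auto
  then have r4: "(\<Prod>i<N. - (q ^ Suc i)) = 1 / ?P N" using P0 by (simp add: field_simps)
  have nz: "qpoch (A * e) q s \<noteq> 0" "qpoch (d * q) q s \<noteq> 0"
    using qpoch_Ae_ne[of s 0] dne assms by (simp_all add: qpoch_nonzero)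
  \<comment> \<open>The powers of t from e^s, D^N and t^-M add up to zero. This is why the closed
    form is regular at t = 0.\<close>
  have pw: "e ^ s * q ^ (s * N) * D ^ N / t ^ M = (g * q) ^ M"
  proof -
    have "e ^ s * q ^ (s * N) = 1 / D ^ s"
      using nonzero by (simp add: power_mult_distrib power_divide flip: power_mult) (simp add: mult.commute)
    then show ?thesis using nonzero by (simp add: N power_add power_mult_distrib)
  qed
  have D2: "t * g * q\<^sup>2 = D * q" by (simp add: power2_eq_square)
  have K0: "mass 0 = 1 / ?P N * (?P N / D ^ N * qpoch (D * q) q N)
     / (qpoch q q N * (qpoch (d * q) q s * qpoch (d * q * q ^ s) q M)
        * (qpoch (A * e) q s * (?P M / t ^ M * qpoch (t * q) q M)))"
  proof -
    have "mass 0 = (\<Prod>i<N. - (q ^ Suc i)) * qpoch e q N / (qpoch q q N * qpoch (d * q) q N * qpoch (A * e) q N)"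
      using mass_eq[of 0] by simp
    then show ?thesis by (simp only: r1 r2 r3 r4)
  qed
  have xd: "(\<Prod>i\<in>{0..N} - {s}. qlat q C s - qlat q C i)
     = qpoch q q s * qpoch q q M * ?P M / q ^ (s * N) * (\<Prod>i\<in>{0..N} - {s}. 1 - C * q ^ (s + i))"
    unfolding N by (rule prod_qlat_diff[OF nonzero(1)])
  have v: "vwp q A H e s = qpoch A q s * qpoch H q s / (qpoch (d * q) q s * qpoch (A * e) q s) * e ^ s"
    unfolding vwp_def He ..
  have NM: "N - s = M" by (simp add: N)
  have gen: "(es * sN * DN / tM) * qN / (qs * qM) * (As * Hs * tq * dM) / (Dq * X)
     = As * Hs / (ds * Aes) * es / (qs * qM * pM / sN * X)
       / (1 / pN * (pN / DN * Dq) / (qN * (ds * dM) * (Aes * (pM / tM * tq))))"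
    if "ds \<noteq> 0" "Aes \<noteq> 0" "pM \<noteq> 0" "pN \<noteq> 0" for es sN DN tM qN qs qM As Hs tq dM Dq X ds Aes pM pN :: real
    using that by (simp add: mult_ac)
  show ?thesis
    unfolding racah_wt_def NM D2 v xd K0 pw[symmetric]
    by (rule gen) (use nz P0 in auto)
qed

lemma racah_wt_orthogonality:
  assumes "n \<le> N" "m \<le> N"
  shows "(\<Sum>s=0..N. poly (U n) (qlat q C s) * poly (U m) (qlat q C s) * racah_wt q g d t N s)
     = (if n = m then U_norm n else 0)"
proof -
  have "(\<Sum>s=0..N. poly (U n) (qlat q C s) * poly (U m) (qlat q C s) * racah_wt q g d t N s)
      = L (U n * U m) / mass 0"
    unfolding L_def divdiff_def sum_divide_distrib
    by (intro sum.cong) (simp_all add: racah_wt_eq mult_ac)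
  then show ?thesis using L_U_U[OF assms] mass_nonzero by simp
qed

end

section \<open>The weights\<close>

lemma convergent_prod_qpoch_inf:
  fixes q x :: real
  assumes "0 < q" "q < 1"
  shows "convergent_prod (\<lambda>i. 1 - x * q ^ i)"
proof (intro abs_convergent_prod_imp_convergent_prod summable_imp_abs_convergent_prod)
  have "summable (\<lambda>i. \<bar>x\<bar> * q ^ i)" using assms by (intro summable_mult summable_geometric) simp
  then show "summable (\<lambda>i. norm (1 - x * q ^ i - 1))" using assms by (simp add: abs_mult)
qed

lemma qpoch_inf_nonzero:
  assumes "0 < q" "q < 1" "\<And>i. x * q ^ i \<noteq> 1"
  shows "qpoch_inf x q \<noteq> 0"
  unfolding qpoch_inf_def using assms by (intro prodinf_nonzero convergent_prod_qpoch_inf) auto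

lemma qpoch_inf_shift:
  assumes "0 < q" "q < 1" "x \<noteq> 1"
  shows "qpoch_inf x q = (1 - x) * qpoch_inf (x * q) q"
  using prodinf_split_head[OF convergent_prod_qpoch_inf[OF assms(1,2)], of x] assms(3)
  by (simp add: qpoch_inf_def mult.assoc)

lemma powr_mult_power_eq_1_iff:
  assumes "0 < q" "q < (1::real)"
  shows "q powr z * q ^ i = 1 \<longleftrightarrow> z + real i = 0"
proof -
  have "q powr z * q ^ i = q powr (z + real i)"
    using assms by (simp add: powr_add powr_realpow)
  then show ?thesis using assms by (simp add: powr_eq_one_iff_gen)
qed

lemma kappa_nonzero: "0 < q \<Longrightarrow> q < 1 \<Longrightarrow> kappa q \<noteq> 0"
  using powr_less_mono'[of q "-(1/2)" "1/2"] by (simp add: kappa_def)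

lemma qnum_eq: "qnum q z = - (q powr (- (z / 2)) * (1 - q powr z)) / kappa q"
proof -
  have "q powr (- (z / 2)) * q powr z = q powr (z / 2)" by (simp flip: powr_add)
  then show ?thesis by (simp add: qnum_def kappa_def algebra_simps)
qed

lemma qnum_eq_0_iff:
  assumes "0 < q" "q < 1"
  shows "qnum q z = 0 \<longleftrightarrow> z = 0"
  using assms kappa_nonzero[OF assms] powr_mult_power_eq_1_iff[OF assms, of z 0] by (auto simp: qnum_eq)

lemma tGamma_nonzero:
  assumes "0 < q" "q < 1" "\<And>i. z + real i \<noteq> 0"
  shows "tGamma q z \<noteq> 0"
  unfolding tGamma_def
  using assms qpoch_inf_nonzero[OF assms(1,2), of "q powr z"] qpoch_inf_nonzero[OF assms(1,2), of q]
    powr_mult_power_eq_1_iff[OF assms(1,2), of z] powr_mult_power_eq_1_iff[OF assms(1,2), of 1]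
  by auto

lemma tGamma_one: "0 < q \<Longrightarrow> q < 1 \<Longrightarrow> tGamma q 1 = 1"
  using tGamma_nonzero[of q 1] by (auto simp: tGamma_def add_eq_0_iff)

lemma tGamma_Suc:
  assumes q: "0 < q" "q < 1" and z: "z \<noteq> 0"
  shows "tGamma q (z + 1) = qnum q z * tGamma q z"
proof -
  have 1: "q powr (- ((z + 1 - 1) * (z + 1 - 2) / 4)) = q powr (- ((z - 1) * (z - 2) / 4)) * q powr (1/2 - z/2)"
    unfolding powr_add[symmetric] by (rule arg_cong[of _ _ "\<lambda>x. q powr x"]) (simp add: field_simps)
  have 2: "(1 - q) powr (1 - z) = (1 - q) powr (1 - (z + 1)) * (1 - q)"
    using powr_add[of "1 - q" "- z" 1] q by simp
  have X: "q powr z \<noteq> 1" using powr_mult_power_eq_1_iff[OF q, of z 0] z by simp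
  have 3: "qpoch_inf (q powr z) q = (1 - q powr z) * qpoch_inf (q powr (z + 1)) q"
    using qpoch_inf_shift[OF q X] q by (simp add: powr_add)
  have 4: "qnum q z * (1 - q) = q powr (1/2 - z/2) * (1 - q powr z)"
  proof -
    \<comment> \<open>With square roots as variables the half powers become rational
      expressions.\<close>
    define h where "h = q powr (1/2)"
    define w where "w = q powr (z/2)"
    have hw: "h > 0" "w > 0" using q by (auto simp: h_def w_def)
    have sq: "q = h\<^sup>2" "q powr z = w\<^sup>2"
      using q by (auto simp: h_def w_def power2_eq_square simp flip: powr_add)
    have d: "q powr (1/2 - z/2) = h / w" unfolding h_def w_def by (rule powr_diff)
    have k: "h - 1 / h \<noteq> 0" using kappa_nonzero[OF q] by (simp add: kappa_def h_def powr_minus_divide)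
    have "qnum q z = (w - 1 / w) / (h - 1 / h)"
      by (simp add: qnum_def h_def w_def powr_minus_divide)
    then have "qnum q z * (h - 1 / h) = w - 1 / w" using k by simp
    then have "qnum q z * (1 - h\<^sup>2) = - h * (w - 1 / w)"
      using hw by (simp add: field_simps power2_eq_square)
    also have "\<dots> = h / w * (1 - w\<^sup>2)" using hw by (simp add: field_simps power2_eq_square)
    finally show ?thesis unfolding d sq(2) by (subst (2) sq(1))
  qed
  have q1: "1 - q \<noteq> 0" using q by simp
  have "tGamma q (z + 1) = q powr (- ((z - 1) * (z - 2) / 4)) * (1 - q) powr (1 - (z + 1))
    * (q powr (1/2 - z/2) * (1 - q powr z)) * (qpoch_inf q q / ((1 - q powr z) * qpoch_inf (q powr (z + 1)) q))"
    unfolding tGamma_def 1 using X by simp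
  also have "\<dots> = qnum q z * tGamma q z"
    unfolding tGamma_def 3[symmetric] 4[symmetric] 2 by simp
  finally show ?thesis .
qed

abbreviation qnums :: "real \<Rightarrow> real \<Rightarrow> nat \<Rightarrow> real" where
  "qnums q z n \<equiv> \<Prod>i<n. qnum q (z + real i)"

lemma tGamma_add:
  assumes "0 < q" "q < 1" "\<And>i. z + real i \<noteq> 0"
  shows "tGamma q (z + real n) = qnums q z n * tGamma q z"
proof (induction n)
  case (Suc n)
  then show ?case using tGamma_Suc[OF assms(1,2,3), of n] by (simp add: add_ac mult_ac)
qed simp

text \<open>Each symmetric q-number gives up a factor q^(-(z+i)/2); n(n-1)/4 is half the sum of the
  shifts 0, ..., n - 1.\<close>

lemma qnums_eq:
  assumes "0 < q"
  shows "qnums q z n = (- 1 / kappa q) ^ n * q powr (- (real n * z / 2 + real n * (real n - 1) / 4))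
           * qpoch (q powr z) q n"
proof (induction n)
  case 0
  then show ?case using assms by simp
next
  case (Suc n)
  have "qnum q (z + real n) = (- 1 / kappa q) * q powr (- ((z + real n) / 2)) * (1 - q powr z * q ^ n)"
    using assms by (simp add: qnum_eq powr_add powr_realpow)
  moreover have "q powr (- (real n * z / 2 + real n * (real n - 1) / 4)) * q powr (- ((z + real n) / 2))
     = q powr (- (real (Suc n) * z / 2 + real (Suc n) * (real (Suc n) - 1) / 4))"
    unfolding powr_add[symmetric] by (rule arg_cong[of _ _ "\<lambda>x. q powr x"]) (simp add: field_simps)
  moreover have "qnums q z (Suc n) = qnums q z n * qnum q (z + real n)" by simp
  ultimately show ?case unfolding Suc by (simp add: qpoch_Suc mult_ac)
qed

section \<open>The q-Racah weight with its singularities removed\<close>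

lemma eventually_nonpole:
  fixes c k :: real
  assumes "k \<noteq> 0"
  shows "eventually (\<lambda>x. \<forall>i::nat. c + k * x + real i \<noteq> 0) (at 0)"
proof -
  \<comment> \<open>For |x| < 1 only indices below m can give a zero, each at a single x, so
    finitely many points have to be avoided.\<close>
  obtain m :: nat where m: "\<bar>c\<bar> + \<bar>k\<bar> < real m" using reals_Archimedean2 by blast
  have "eventually (\<lambda>x. \<forall>i<m. x \<noteq> - (c + real i) / k) (at 0)"
    by (simp only: lessThan_iff[symmetric] Ball_def[symmetric])
       (intro eventually_ball_finite ballI eventually_neq_at_within finite_lessThan)
  moreover have "eventually (\<lambda>x::real. \<bar>x\<bar> < 1) (at 0)"
    using eventually_at[of "\<lambda>x::real. \<bar>x\<bar> < 1" 0 UNIV] by (auto simp: dist_norm intro: exI[of _ 1])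
  ultimately show ?thesis
  proof eventually_elim
    case (elim x)
    show ?case
    proof
      fix i :: nat
      show "c + k * x + real i \<noteq> 0"
      proof (cases "i < m")
        case True
        then show ?thesis using elim assms by (auto simp: field_simps)
      next
        case False
        have "\<bar>k * x\<bar> \<le> \<bar>k\<bar> * 1" unfolding abs_mult using elim by (intro mult_left_mono) auto
        then show ?thesis using False m by linarith
      qed
    qed
  qed
qed

lemma tendsto_qnum:
  assumes "0 < q" "(f \<longlongrightarrow> l) F"
  shows "((\<lambda>x. qnum q (f x)) \<longlongrightarrow> qnum q l) F"
  unfolding qnum_def using assms kappa_nonzero
  \<comment> \<open>For q = 1, which the assumptions admit, the denominator is 0 and
    \<open>qnum\<close> vanishes identically.\<close>
  by (cases "q powr (1/2) - q powr - (1/2) = 0") (auto intro!: tendsto_intros)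

text \<open>What is left of the weight, perturbed by x as in \<open>qracah_weight\<close>, once the
  q-gamma values have been paired off. The missing index i = s is the factor cancelled against
  [2(s+a+x)+1]_q.\<close>

definition qnum_weight :: "real \<Rightarrow> real \<Rightarrow> real \<Rightarrow> real \<Rightarrow> nat \<Rightarrow> nat \<Rightarrow> real \<Rightarrow> real" where
  "qnum_weight q \<alpha> \<beta> a N s x =
     qnums q (\<beta> + x + 1) s * qnums q (2 * a + 2 * x + 1 + (real N + 1 + \<alpha>)) s * qnums q (\<alpha> + 1) (N - s)
     * qnums q 1 N * qnums q (real s + 2 * a - \<beta> + 1 + x) (N - s)
     / (qnums q 1 s * (\<Prod>i\<in>{0..N} - {s}. qnum q (2 * a + 2 * x + 1 + real s + real i))
        * qnums q 1 (N - s) * qnums q (\<alpha> + \<beta> + 2 + x) N)"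

text \<open>Every q-gamma argument is a nonnegative integer shift of one of seven base points, and
  the regularity hypotheses keep the nontrivial ones off the poles, so their values cancel.\<close>

lemma rho_eq_qnum_weight:
  assumes q: "0 < q" "q < 1" and b: "b = a + real N + 1" and s: "s \<le> N"
    and reg: "\<And>i::nat. 2 * a + 2 * x + 1 + real s + real i \<noteq> 0" "\<And>i::nat. \<beta> + x + 1 + real i \<noteq> 0"
      "\<And>i::nat. real s + 2 * a - \<beta> + 1 + x + real i \<noteq> 0"
      "\<And>i::nat. 2 * a + 2 * x + 1 + (real N + 1 + \<alpha>) + real i \<noteq> 0"
      "\<And>i::nat. \<alpha> + \<beta> + 2 + x + real i \<noteq> 0" "\<And>i::nat. \<alpha> + 1 + real i \<noteq> 0"
  shows "qracah_rho q \<alpha> (\<beta> + x) (a + x) (b + x) (real s + a + x) * qnum q (2 * (real s + a + x) + 1)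
     = qnum_weight q \<alpha> \<beta> a N s x"
proof -
  define M where "M = N - s"
  have N: "real N = real s + real M" using s by (simp add: M_def)
  define w y v r where "w = 2 * a + 2 * x + 1 + real s" and "y = 2 * a + 2 * x + 1 + (real N + 1 + \<alpha>)"
    and "v = \<alpha> + \<beta> + 2 + x" and "r = real s + 2 * a - \<beta> + 1 + x"
  have args: "real s + a + x + (a + x) + 1 = w" "real s + a + x - (a + x) + (\<beta> + x) + 1 = \<beta> + x + 1 + real s"
     "real s + a + x + \<alpha> + (b + x) + 1 = y + real s" "b + x + \<alpha> - (real s + a + x) = \<alpha> + 1 + real M"
     "\<alpha> + (\<beta> + x) + 2 = v" "b + x - (a + x) = 1 + real N" "a + x + (b + x) - (\<beta> + x) = r + real M"
     "real s + a + x - (a + x) + 1 = 1 + real s" "real s + a + x + (b + x) + 1 = w + real (Suc N)"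
     "real s + a + x + (a + x) - (\<beta> + x) + 1 = r" "b + x - (real s + a + x) = 1 + real M"
     "1 + real N + \<alpha> + (\<beta> + x) + 1 = v + real N" "a + x + (b + x) + \<alpha> + 1 = y"
     "2 * (real s + a + x) + 1 = w + real s"
    unfolding b w_def y_def v_def r_def by (simp_all add: N)
  have one: "\<And>i::nat. 1 + real i \<noteq> 0" by linarith
  note reg' = reg[folded w_def y_def v_def r_def]
  note G = tGamma_add[OF q reg'(1)] tGamma_add[OF q reg'(2)] tGamma_add[OF q reg'(3)]
     tGamma_add[OF q reg'(4)] tGamma_add[OF q reg'(5)] tGamma_add[OF q reg'(6)] tGamma_add[OF q one]
  note nz = tGamma_nonzero[OF q reg'(1)] tGamma_nonzero[OF q reg'(2)] tGamma_nonzero[OF q reg'(3)]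
     tGamma_nonzero[OF q reg'(4)] tGamma_nonzero[OF q reg'(5)] tGamma_nonzero[OF q reg'(6)] tGamma_nonzero[OF q one]
  have nw: "qnum q (w + real s) \<noteq> 0" using qnum_eq_0_iff[OF q] reg'(1)[of s] by simp
  have ws: "qnums q w (Suc N) = qnum q (w + real s) * (\<Prod>i\<in>{0..N} - {s}. qnum q (w + real i))"
    using prod.remove[of "{0..N}" s "\<lambda>i. qnum q (w + real i)"] s
    by (simp add: lessThan_Suc_atMost atLeast0AtMost)
  \<comment> \<open>The base value g7, at the point 1, stands once above and twice below; it
    disappears only because it equals 1.\<close>
  have gen: "g1 * (p2 * g2) * (p4 * g4) * (p6 * g6) * g5 * (p7 * g7) * (p3 * g3)
      / ((o7 * g7) * ((k * p1) * g1) * g3 * (m7 * g7) * g6 * g2 * (p5 * g5) * g4) * k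
     = p2 * p4 * p6 * p7 * p3 / (o7 * p1 * m7 * p5)"
    if "g1 \<noteq> 0" "g2 \<noteq> 0" "g3 \<noteq> 0" "g4 \<noteq> 0" "g5 \<noteq> 0" "g6 \<noteq> 0" "g7 = 1" "k \<noteq> 0"
    for g1 g2 g3 g4 g5 g6 g7 p1 p2 p3 p4 p5 p6 p7 o7 m7 k :: real
    using that by (simp add: mult_ac)
  show ?thesis
    unfolding qracah_rho_def args G ws qnum_weight_def M_def[symmetric] w_def[symmetric] y_def[symmetric]
      v_def[symmetric] r_def[symmetric]
    by (rule gen) (use nz nw tGamma_one[OF q] in auto)
qed

text \<open>The factor -1/kappa occurs 3N times above and 3N times below. The exponents of q cancel
  up to (\<beta> + 1)(N - s), which is the power of \<gamma>q in the closed form.\<close>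

lemma qnum_weight_eq_racah_wt:
  assumes q: "0 < q" "q < 1" and s: "s \<le> N"
  shows "qnum_weight q \<alpha> \<beta> a N s 0 = racah_wt q (q powr \<beta>) (q powr (2 * a - \<beta>)) (q powr \<alpha>) N s"
proof -
  define M where "M = N - s"
  have N: "N = s + M" using s by (simp add: M_def)
  let ?k = "- 1 / kappa q"
  let ?E = "\<lambda>n z. - (real n * z / 2 + real n * (real n - 1) / 4)"
  let ?w = "2 * a + 1 + real s"
  have k: "?k \<noteq> 0" using kappa_nonzero[OF q] by simp
  have gd: "q powr \<beta> * q powr (2 * a - \<beta>) = q powr (2 * a)" by (simp flip: powr_add)
  have p: "q powr (real n) = q ^ n" for n using q by (simp add: powr_realpow)
  have a1: "q powr (\<beta> + 0 + 1) = q powr \<beta> * q" using q by (simp add: powr_add)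
  have a2: "q powr (2 * a + 2 * 0 + 1 + (real N + 1 + \<alpha>)) = q powr \<alpha> * q powr \<beta> * q powr (2 * a - \<beta>) * q ^ (N + 2)"
    using q unfolding mult.assoc gd by (simp add: powr_add p mult_ac power2_eq_square)
  have a3: "q powr (\<alpha> + 1) = q powr \<alpha> * q" using q by (simp add: powr_add)
  have a4: "q powr (real s + 2 * a - \<beta> + 1 + 0) = q powr (2 * a - \<beta>) * q * q ^ s"
  proof -
    have "real s + 2 * a - \<beta> + 1 + 0 = 2 * a - \<beta> + 1 + real s" by simp
    then show ?thesis using q by (simp only: powr_add p powr_one less_imp_le)
  qed
  have a5: "q powr (\<alpha> + \<beta> + 2 + 0) = q powr \<alpha> * q powr \<beta> * q\<^sup>2"
    using q p[of 2] by (simp add: powr_add power2_eq_square)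
  have a6: "q powr ?w = q powr \<beta> * q powr (2 * a - \<beta>) * q * q ^ s"
    using q unfolding gd by (simp add: powr_add p)
  \<comment> \<open>The exponent is that of all N + 1 factors, with the share (\<open>?w\<close> +
    s)/2 of the omitted factor added back.\<close>
  have den: "(\<Prod>i\<in>{0..N} - {s}. qnum q (2 * a + 2 * 0 + 1 + real s + real i))
     = ?k ^ N * q powr (?E (Suc N) ?w + (2 * a + 1 + real s + real s) / 2)
       * (\<Prod>i\<in>{0..N} - {s}. 1 - q powr \<beta> * q powr (2 * a - \<beta>) * q * q ^ (s + i))"
  proof -
    have "(\<Prod>i\<in>{0..N} - {s}. qnum q (?w + real i)) = qnums q ?w s * qnums q (?w + real (Suc s)) M"
      unfolding N prod_remove_split by (simp add: add_ac)
    also have "\<dots> = ?k ^ (s + M) * (q powr (?E s ?w) * q powr (?E M (?w + real (Suc s))))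
        * (qpoch (q powr ?w) q s * qpoch (q powr (?w + real (Suc s))) q M)"
      unfolding qnums_eq[OF q(1)] power_add by (simp only: mult_ac)
    also have "q powr (?E s ?w) * q powr (?E M (?w + real (Suc s)))
        = q powr (?E (Suc N) ?w + (2 * a + 1 + real s + real s) / 2)"
      unfolding powr_add[symmetric] N by (rule arg_cong[of _ _ "\<lambda>x. q powr x"]) (simp add: field_simps)
    also have "qpoch (q powr ?w) q s * qpoch (q powr (?w + real (Suc s))) q M
        = (\<Prod>i\<in>{0..N} - {s}. 1 - q powr \<beta> * q powr (2 * a - \<beta>) * q * q ^ (s + i))"
    proof -
      have "q powr (?w + real (Suc s)) = q powr ?w * q ^ Suc s"
        by (simp only: powr_add p)
      then show ?thesis
        unfolding N prod_remove_split qpoch_def a6 by (simp add: power_add mult_ac)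
    qed
    finally show ?thesis by (simp add: N)
  qed
  have E: "q powr ?E s (\<beta> + 0 + 1) * q powr ?E s (2 * a + 2 * 0 + 1 + (real N + 1 + \<alpha>)) * q powr ?E M (\<alpha> + 1)
      * q powr ?E N 1 * q powr ?E M (real s + 2 * a - \<beta> + 1 + 0)
    = (q powr \<beta> * q) ^ M * (q powr ?E s 1 * q powr (?E (Suc N) ?w + (2 * a + 1 + real s + real s) / 2)
       * q powr ?E M 1 * q powr ?E N (\<alpha> + \<beta> + 2 + 0))"
  proof -
    have "(q powr \<beta> * q) ^ M = (q powr (\<beta> + 1)) powr real M"
      using q by (simp add: powr_realpow powr_add)
    then have "(q powr \<beta> * q) ^ M = q powr ((\<beta> + 1) * real M)" by (simp only: powr_powr)
    then show ?thesis
      by (simp only: powr_add[symmetric]) (rule arg_cong[of _ _ "\<lambda>x. q powr x"], simp add: N field_simps)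
  qed
  have gen: "(k ^ s * e1 * P1) * (k ^ s * e2 * P2) * (k ^ M * e3 * P3) * (k ^ N * e4 * P4) * (k ^ M * e5 * P5)
     / ((k ^ s * f1 * Q1) * (k ^ N * f2 * Q2) * (k ^ M * f3 * Q3) * (k ^ N * f4 * Q4))
     = G * P4 / (Q1 * Q3) * (P1 * P2 * P3 * P5) / (Q4 * Q2)"
    if "e1 * e2 * e3 * e4 * e5 = G * (f1 * f2 * f3 * f4)" "f1 \<noteq> 0" "f2 \<noteq> 0" "f3 \<noteq> 0" "f4 \<noteq> 0" "k \<noteq> 0"
    for k e1 e2 e3 e4 e5 f1 f2 f3 f4 G P1 P2 P3 P4 P5 Q1 Q2 Q3 Q4 :: real
  proof -
    have "(k ^ s * e1 * P1) * (k ^ s * e2 * P2) * (k ^ M * e3 * P3) * (k ^ N * e4 * P4) * (k ^ M * e5 * P5)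
       = (k ^ s * k ^ s * k ^ M * k ^ N * k ^ M) * (e1 * e2 * e3 * e4 * e5) * (P1 * P2 * P3 * P4 * P5)"
      by (simp only: mult_ac)
    also have "k ^ s * k ^ s * k ^ M * k ^ N * k ^ M = k ^ s * k ^ N * k ^ M * k ^ N"
      by (simp add: N power_add mult_ac)
    finally have num: "(k ^ s * e1 * P1) * (k ^ s * e2 * P2) * (k ^ M * e3 * P3) * (k ^ N * e4 * P4) * (k ^ M * e5 * P5)
       = (k ^ s * k ^ N * k ^ M * k ^ N) * (G * (f1 * f2 * f3 * f4)) * (P1 * P2 * P3 * P4 * P5)"
      unfolding that(1) .
    have den: "(k ^ s * f1 * Q1) * (k ^ N * f2 * Q2) * (k ^ M * f3 * Q3) * (k ^ N * f4 * Q4)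
       = (k ^ s * k ^ N * k ^ M * k ^ N) * (f1 * f2 * f3 * f4) * (Q1 * Q2 * Q3 * Q4)"
      by (simp only: mult_ac)
    have "X * (G * F) * P / (X * F * Q) = G * P / Q" if "X \<noteq> 0" "F \<noteq> 0" for X F P Q :: real
      using that by simp
    from this[of "k ^ s * k ^ N * k ^ M * k ^ N" "f1 * f2 * f3 * f4"] show ?thesis
      unfolding num den using that(2-) by (simp add: mult_ac)
  qed
  show ?thesis
    unfolding qnum_weight_def racah_wt_def M_def[symmetric] den qnums_eq[OF q(1)] a1 a2 a3 a4 a5
      powr_one[OF less_imp_le[OF q(1)]]
    by (rule gen) (use E k q in simp_all)
qed

text \<open>For small nonzero perturbations all arguments are regular and the cancelled form holds.
  It is continuous at 0, since the hypothesis \<open>reg\<close> concerns indices other than s only,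
  so the \<open>Lim\<close> is its value there.\<close>

lemma qracah_weight_eq:
  assumes q: "0 < q" "q < 1" and b: "b = a + real N + 1" and s: "s \<le> N"
    and pos: "0 < \<alpha> + 1" "0 < \<alpha> + \<beta> + 2" "0 < 2 * a + real N + 2 + \<alpha>"
    and reg: "\<And>i. i \<in> {0..N} - {s} \<Longrightarrow> q powr (2 * a) * q * q ^ (s + i) \<noteq> 1"
  shows "qracah_weight q \<alpha> \<beta> a b (real s + a)
           = racah_wt q (q powr \<beta>) (q powr (2 * a - \<beta>)) (q powr \<alpha>) N s"
proof -
  have 1: "eventually (\<lambda>x. \<forall>i::nat. 2 * a + 1 + real s + 2 * x + real i \<noteq> 0) (at 0)"
    by (rule eventually_nonpole) simp
  have 2: "eventually (\<lambda>x. \<forall>i::nat. \<beta> + 1 + 1 * x + real i \<noteq> 0) (at 0)"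
    by (rule eventually_nonpole) simp
  have 3: "eventually (\<lambda>x. \<forall>i::nat. real s + 2 * a - \<beta> + 1 + 1 * x + real i \<noteq> 0) (at 0)"
    by (rule eventually_nonpole) simp
  have 4: "eventually (\<lambda>x. \<forall>i::nat. 2 * a + 1 + (real N + 1 + \<alpha>) + 2 * x + real i \<noteq> 0) (at 0)"
    by (rule eventually_nonpole) simp
  have 5: "eventually (\<lambda>x. \<forall>i::nat. \<alpha> + \<beta> + 2 + 1 * x + real i \<noteq> 0) (at 0)"
    by (rule eventually_nonpole) simp
  have ev: "eventually (\<lambda>x. qracah_rho q \<alpha> (\<beta> + x) (a + x) (b + x) (real s + a + x)
      * qnum q (2 * (real s + a + x) + 1) = qnum_weight q \<alpha> \<beta> a N s x) (at 0)"
    using 1 2 3 4 5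
  proof eventually_elim
    case (elim x)
    have "\<alpha> + 1 + real i \<noteq> 0" for i :: nat using pos by linarith
    then show ?case using elim
      by (intro rho_eq_qnum_weight[OF q b s]) (simp_all add: add_ac)
  qed
  have "(qnum_weight q \<alpha> \<beta> a N s \<longlongrightarrow> qnum_weight q \<alpha> \<beta> a N s 0) (at 0)"
  proof -
    have n1: "qnums q 1 m \<noteq> 0" for m
      using qnum_eq_0_iff[OF q] by (simp add: add_nonneg_eq_0_iff)
    have n2: "(\<Prod>i\<in>{0..N} - {s}. qnum q (2 * a + 2 * 0 + 1 + real s + real i)) \<noteq> 0"
    proof -
      have "2 * a + 2 * 0 + 1 + real s + real i \<noteq> 0" if "i \<in> {0..N} - {s}" for i
      proof -
        have "q powr (2 * a + 1) * q ^ (s + i) \<noteq> 1" using reg[OF that] q by (simp add: powr_add)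
        then show ?thesis using powr_mult_power_eq_1_iff[OF q, of "2 * a + 1" "s + i"] by simp
      qed
      then show ?thesis using qnum_eq_0_iff[OF q] by simp
    qed
    have n3: "qnums q (\<alpha> + \<beta> + 2 + 0) N \<noteq> 0"
    proof -
      have "\<alpha> + \<beta> + 2 + 0 + real i \<noteq> 0" for i using pos by linarith
      then show ?thesis using qnum_eq_0_iff[OF q] by simp
    qed
    have den: "qnums q 1 s * (\<Prod>i\<in>{0..N} - {s}. qnum q (2 * a + 2 * 0 + 1 + real s + real i))
        * qnums q 1 (N - s) * qnums q (\<alpha> + \<beta> + 2 + 0) N \<noteq> 0"
      using n1 n2 n3 by (simp only: mult_eq_0_iff) simp
    show ?thesis
      unfolding qnum_weight_def
      by (intro tendsto_divide tendsto_mult tendsto_prod tendsto_qnum tendsto_add tendsto_const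
           tendsto_ident_at q(1) den)
  qed
  then have "((\<lambda>x. qracah_rho q \<alpha> (\<beta> + x) (a + x) (b + x) (real s + a + x)
      * qnum q (2 * (real s + a + x) + 1)) \<longlongrightarrow> qnum_weight q \<alpha> \<beta> a N s 0) (at 0)"
    using tendsto_cong[OF ev] by blast
  then have "qracah_weight q \<alpha> \<beta> a b (real s + a) = qnum_weight q \<alpha> \<beta> a N s 0"
    unfolding qracah_weight_def by (intro tendsto_Lim) simp_all
  then show ?thesis using qnum_weight_eq_racah_wt[OF q s] by simp
qed

section \<open>The dual q-Hahn weight\<close>

lemma qpoch_neg_power:
  assumes "q \<noteq> 0"
  shows "qpoch (1 / q ^ (s + M)) q s * q ^ ((s + M) * s) * qpoch q q M
     = (-1) ^ s * q ^ (s choose 2) * qpoch q q (s + M)"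
proof -
  have "qpoch (1 / (q ^ M * q ^ s)) q s = (\<Prod>i<s. - 1 / (q ^ M * q ^ Suc i)) * qpoch (q ^ M * q) q s"
    using assms by (intro qpoch_reverse) auto
  \<comment> \<open>The powers from the reversal, multiplied by q^(N s), reduce to q^(s choose 2).
    This accounts for the exponent in \<open>dqh_rho\<close>.\<close>
  moreover have "(\<Prod>i<s. - 1 / (q ^ M * q ^ Suc i)) * q ^ ((s + M) * s) = (-1) ^ s * q ^ (s choose 2)"
  proof (induction s)
    case (Suc s)
    have "(Suc s + M) * Suc s = (s + M) * s + (M + Suc s + s)" by (simp add: algebra_simps)
    then have "(\<Prod>i<Suc s. - 1 / (q ^ M * q ^ Suc i)) * q ^ ((Suc s + M) * Suc s)
       = ((\<Prod>i<s. - 1 / (q ^ M * q ^ Suc i)) * q ^ ((s + M) * s))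
         * (- 1 / (q ^ M * q ^ Suc s) * (q ^ M * q ^ Suc s * q ^ s))"
      by (simp only: prod.lessThan_Suc power_add mult_ac)
    also have "- 1 / (q ^ M * q ^ Suc s) * (q ^ M * q ^ Suc s * q ^ s) = - (q ^ s)"
      using assms by simp
    finally show ?case unfolding Suc
      by (simp add: numeral_2_eq_2 power_add)
  qed (simp add: numeral_2_eq_2)
  moreover have "qpoch q q (s + M) = qpoch q q M * qpoch (q ^ M * q) q s"
    using qpoch_add[of q q M s] by (simp add: add.commute mult.commute)
  moreover have "q ^ (s + M) = q ^ M * q ^ s" by (simp add: power_add)
  ultimately show ?thesis by (simp add: mult_ac)
qed

lemma fdiff_dqh_x:
  assumes "0 < q"
  shows "fdiff (dqh_x q g d) (real s - 1/2) = - kappa q * (1 - g * d * q * q ^ (2 * s)) / q ^ s"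
proof -
  define h where "h = q powr (1/2)"
  have h: "h \<noteq> 0" using assms by (simp add: h_def)
  have hq: "h * h = q" using assms by (simp add: h_def flip: powr_add)
  have p: "q powr real s = q ^ s" using assms by (simp add: powr_realpow)
  have e1: "q powr (- (real s - 1/2 + 1)) = 1 / h / q ^ s"
    and e2: "q powr (real s - 1/2 + 1 + 1) = q ^ s * h * q"
    and e3: "q powr (- (real s - 1/2)) = h / q ^ s"
    and e4: "q powr (real s - 1/2 + 1) = q ^ s * h"
  proof -
    have "- (real s - 1/2 + 1) = - (1/2) - real s" "real s - 1/2 + 1 + 1 = real s + 1/2 + 1"
      "- (real s - 1/2) = 1/2 - real s" "real s - 1/2 + 1 = real s + 1/2" by simp_all
    then show "q powr (- (real s - 1/2 + 1)) = 1 / h / q ^ s" "q powr (real s - 1/2 + 1 + 1) = q ^ s * h * q"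
      "q powr (- (real s - 1/2)) = h / q ^ s" "q powr (real s - 1/2 + 1) = q ^ s * h"
      using assms by (simp_all only: powr_diff powr_add p powr_one h_def powr_minus_divide less_imp_le)
  qed
  have kap: "kappa q = h - 1 / h" by (simp add: kappa_def h_def powr_minus_divide)
  have "1 / h / q ^ s + g * d * (q ^ s * h * q) - (h / q ^ s + g * d * (q ^ s * h))
      = - (h - 1 / h) * (1 - g * d * q * (q ^ s * q ^ s)) / q ^ s"
  proof -
    have "(1 / h - h + g * d * (h * (q - 1)) * (q ^ s * q ^ s)) = - (h - 1 / h) * (1 - g * d * q * (q ^ s * q ^ s))"
      unfolding hq[symmetric] using h by (simp add: field_simps)
    moreover have "1 / h / q ^ s + g * d * (q ^ s * h * q) - (h / q ^ s + g * d * (q ^ s * h))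
       = (1 / h - h + g * d * (h * (q - 1)) * (q ^ s * q ^ s)) / q ^ s"
      using assms by (simp add: field_simps)
    ultimately show ?thesis by simp
  qed
  then show ?thesis
    unfolding fdiff_def dqh_x_def e1 e2 e3 e4 kap by (simp add: mult_2 power_add)
qed

lemma dqh_rho_eq_racah_wt:
  assumes q: "0 < q" "q < 1" and s: "s \<le> N" and g: "g \<noteq> 0"
    and gd: "\<And>i. i \<le> 2 * N \<Longrightarrow> g * d * q * q ^ i \<noteq> 1" and d: "\<And>i. i < N \<Longrightarrow> d * q * q ^ i \<noteq> 1"
  shows "dqh_rho q g d N s * fdiff (dqh_x q g d) (real s - 1/2) = racah_wt q g d 0 N s"
proof -
  define M where "M = N - s"
  have N: "N = s + M" using s by (simp add: M_def)
  define C where "C = g * d * q"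
  have Cn: "qpoch (C * q ^ j) q k \<noteq> 0" if "j + k \<le> Suc (2 * N)" for j k
    using gd[of "j + _"] that by (intro qpoch_nonzero) (simp add: C_def power_add mult.assoc)
  have ne: "1 - C \<noteq> 0" "1 - C * q ^ (2 * s) \<noteq> 0" using gd[of 0] gd[of "2 * s"] s by (auto simp: C_def)
  let ?X = "\<Prod>i\<in>{0..N} - {s}. 1 - C * q ^ (s + i)"
  \<comment> \<open>Both sides are (C; q)_(N+1+s): split after s factors, with the factor of index s
    in the second block singled out, and split after 1 and after N + 1 factors.\<close>
  have cancel: "qpoch C q s * ((1 - C * q ^ (2 * s)) * ?X)
     = (1 - C) * qpoch (C * q) q N * qpoch (C * q * q ^ N) q s"
  proof -
    have "qpoch (C * q ^ s) q (Suc N) = (1 - C * q ^ (2 * s)) * ?X"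
      using prod.remove[of "{0..N}" s "\<lambda>i. 1 - C * q ^ (s + i)"] s
      by (simp add: qpoch_def lessThan_Suc_atMost atLeast0AtMost power_add mult_2 mult.assoc)
    moreover have "qpoch C q s * qpoch (C * q ^ s) q (Suc N) = qpoch C q (Suc N + s)"
      using qpoch_add[of C q s "Suc N"] by (simp add: add.commute)
    moreover have "qpoch C q (Suc N + s) = (1 - C) * qpoch (C * q) q N * qpoch (C * q * q ^ N) q s"
      unfolding qpoch_add qpoch_Suc_left[of C q N] by (simp add: mult.assoc)
    ultimately show ?thesis by simp
  qed
  have X: "?X \<noteq> 0"
    using gd[of "s + _"] s by (auto simp: C_def)
  have dq: "qpoch (d * q) q N = qpoch (d * q) q s * qpoch (d * q * q ^ s) q M"
    by (simp add: N qpoch_add)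
  have dn: "qpoch (d * q) q s \<noteq> 0" using d s by (intro qpoch_nonzero) simp
  have qn: "qpoch q q k \<noteq> 0" for k using q by (rule qpoch_self_nonzero)
  have qp: "q powr (real N * real s - real (s choose 2)) = q ^ (N * s) / q ^ (s choose 2)"
    using q by (simp add: powr_diff powr_realpow flip: of_nat_mult)
  have qN: "q powr (- real N) = 1 / q ^ N" using q by (simp add: powr_minus_divide powr_realpow)
  have neg: "qpoch (1 / q ^ N) q s * (q ^ (N * s) / q ^ (s choose 2)) = (-1) ^ s * qpoch q q N / qpoch q q M"
    using qpoch_neg_power[of q s M] q qn[of M] by (simp add: N field_simps)
  have gs: "(g * q) ^ N / ((- g) ^ s * q ^ s) * (-1) ^ s = (g * q) ^ M"
  proof -
    have "(- g) ^ s * q ^ s = (-1) ^ s * (g * q) ^ s"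
      by (subst power_minus) (simp only: power_mult_distrib mult.assoc)
    moreover have "(g * q) ^ s \<noteq> 0" using g q by simp
    ultimately show ?thesis by (simp add: N power_add)
  qed
  have kap: "kappa q \<noteq> 0" using kappa_nonzero[OF q] .
  have C2: "g * d * q\<^sup>2 = C * q" "g * d * q ^ (N + 2) = C * q * q ^ N"
    by (simp_all add: C_def power_add power2_eq_square mult_ac)
  have "dqh_rho q g d N s * fdiff (dqh_x q g d) (real s - 1/2)
    = ((g * q) ^ N * (qpoch (d * q) q s * qpoch (d * q * q ^ s) q M) / qpoch (C * q) q N)
     * ((q ^ (N * s) / q ^ (s choose 2)) / (- kappa q * (1 - C) * (- g) ^ s))
     * (qpoch (g * q) q s * (qpoch C q s * qpoch (1 / q ^ N) q s)
        / (qpoch q q s * (qpoch (C * q * q ^ N) q s * qpoch (d * q) q s)))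
     * (- kappa q * (1 - C * q ^ (2 * s)) / q ^ s)"
    unfolding dqh_rho_def qp qN fdiff_dqh_x[OF q(1)] dq qpochs_def C2 C_def[symmetric] by simp
  also have "\<dots> = ((g * q) ^ N / ((- g) ^ s * q ^ s)) * (qpoch (1 / q ^ N) q s * (q ^ (N * s) / q ^ (s choose 2)))
     * (qpoch (g * q) q s * qpoch (d * q * q ^ s) q M / qpoch q q s)
     * (qpoch C q s * (1 - C * q ^ (2 * s)) / ((1 - C) * qpoch (C * q) q N * qpoch (C * q * q ^ N) q s))"
    using kap dn by (simp add: mult_ac)
  also have "qpoch C q s * (1 - C * q ^ (2 * s)) / ((1 - C) * qpoch (C * q) q N * qpoch (C * q * q ^ N) q s)
      = 1 / ?X"
    unfolding cancel[symmetric] using Cn[of 0 s] ne s by simp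
  also have "qpoch (1 / q ^ N) q s * (q ^ (N * s) / q ^ (s choose 2)) = (-1) ^ s * qpoch q q N / qpoch q q M"
    by (rule neg)
  also have "((g * q) ^ N / ((- g) ^ s * q ^ s)) * ((-1) ^ s * qpoch q q N / qpoch q q M)
     * (qpoch (g * q) q s * qpoch (d * q * q ^ s) q M / qpoch q q s) * (1 / ?X)
     = ((g * q) ^ N / ((- g) ^ s * q ^ s) * (-1) ^ s) * qpoch q q N / (qpoch q q s * qpoch q q M)
     * (qpoch (g * q) q s * qpoch (d * q * q ^ s) q M) / ?X"
    by (simp add: mult_ac)
  finally show ?thesis
    unfolding gs racah_wt_def M_def[symmetric] C_def by (simp add: qpoch_def)
qed

lemma tendsto_qpoch: "(f \<longlongrightarrow> l) F \<Longrightarrow> ((\<lambda>x. qpoch (f x) q n) \<longlongrightarrow> qpoch l q n) F"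
  unfolding qpoch_def by (intro tendsto_intros)

text \<open>Only finitely many values of the first parameter make a denominator vanish, so the
  cancelled form holds on a punctured neighbourhood of \<open>g\<close> even if \<open>g\<close> is
  such a value; continuity does the rest.\<close>

lemma dqh_weight_eq:
  assumes q: "0 < q" "q < 1" and s: "s \<le> N" and pos: "0 < g" "0 < d"
    and gd: "\<And>i. i \<in> {0..N} - {s} \<Longrightarrow> g * d * q * q ^ (s + i) \<noteq> 1" and d: "\<And>i. i < N \<Longrightarrow> d * q * q ^ i \<noteq> 1"
  shows "dqh_weight q g d N s = racah_wt q g d 0 N s"
proof -
  have "eventually (\<lambda>x. x \<noteq> 0) (at g)" by (rule eventually_neq_at_within)
  moreover have "eventually (\<lambda>x. \<forall>i\<in>{..2 * N}. x \<noteq> 1 / (d * q * q ^ i)) (at g)"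
    by (intro eventually_ball_finite ballI eventually_neq_at_within finite_atMost)
  ultimately have ev: "eventually (\<lambda>x. dqh_rho q x d N s * fdiff (dqh_x q x d) (real s - 1/2)
      = racah_wt q x d 0 N s) (at g)"
  proof eventually_elim
    case (elim x)
    have "x * d * q * q ^ i \<noteq> 1" if "i \<le> 2 * N" for i
      using elim(2) that q pos by (auto simp: field_simps)
    then show ?case using elim(1) d by (intro dqh_rho_eq_racah_wt[OF q s]) auto
  qed
  have "((\<lambda>x. racah_wt q x d 0 N s) \<longlongrightarrow> racah_wt q g d 0 N s) (at g)"
  proof -
    have "qpoch q q k \<noteq> 0" for k using q by (rule qpoch_self_nonzero)
    moreover have "(\<Prod>i\<in>{0..N} - {s}. 1 - g * d * q * q ^ (s + i)) \<noteq> 0"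
      using gd by auto
    moreover have "qpoch (0 * g * q\<^sup>2) q N \<noteq> 0" by (simp add: qpoch_def)
    ultimately show ?thesis unfolding racah_wt_def
      by (intro tendsto_intros tendsto_qpoch) (simp_all del: prod_zero_iff)
  qed
  then have "((\<lambda>x. dqh_rho q x d N s * fdiff (dqh_x q x d) (real s - 1/2)) \<longlongrightarrow> racah_wt q g d 0 N s) (at g)"
    using tendsto_cong[OF ev] by blast
  then show ?thesis unfolding dqh_weight_def by (intro tendsto_Lim) simp_all
qed

section \<open>The limit\<close>

lemma qpoch_zero_left [simp]: "qpoch 0 q n = 1"
  by (simp add: qpoch_def)

lemma qpoch_neg_power_eq_0:
  assumes "q \<noteq> 0" "n < k"
  shows "qpoch (1 / q ^ n) q k = 0"
  unfolding qpoch_def using assms by (intro prod_zero) (auto intro!: bexI[of _ n])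

lemma qhyp_terminating:
  assumes "q \<noteq> 0"
  shows "qhyp (1 / q ^ n # as) bs q z
    = (\<Sum>k=0..n. qpochs (1 / q ^ n # as) q k / (qpochs bs q k * qpoch q q k) * z ^ k)"
  unfolding qhyp_def
  by (intro suminf_finite) (simp_all add: qpochs_def qpoch_neg_power_eq_0[OF assms])

text \<open>C_n u_n(s + a) as a function of t. At t = 0 the factorials containing t become 1 and the
  4phi3 collapses to the 3phi2.\<close>

definition racah_poly :: "real \<Rightarrow> real \<Rightarrow> real \<Rightarrow> real \<Rightarrow> nat \<Rightarrow> nat \<Rightarrow> nat \<Rightarrow> real" where
  "racah_poly q g d t N n s =
     qpoch (1 / q ^ N) q n * qpoch (g * q) q n * qpoch (t * g * d * q ^ (N + 2)) q n / qpoch (t * g * q * q ^ n) q n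
     * (\<Sum>k=0..n. qpoch (1 / q ^ n) q k * qpoch (t * g * q * q ^ n) q k
          / (qpoch (1 / q ^ N) q k * qpoch (g * q) q k * qpoch (t * g * d * q ^ (N + 2)) q k * qpoch q q k) * q ^ k
          * (qpoch (1 / q ^ s) q k * qpoch (g * d * q * q ^ s) q k))"

text \<open>C_n^2 d_n^2 as a function of t.\<close>

definition racah_norm :: "real \<Rightarrow> real \<Rightarrow> real \<Rightarrow> real \<Rightarrow> nat \<Rightarrow> nat \<Rightarrow> real" where
  "racah_norm q g d t N n = (g * d * q) ^ n
     * (qpoch q q n * qpoch (t * q) q n * qpoch (g * q) q n * qpoch (t * g * q * q * q ^ N) q n
        * qpoch (t * g * d * q ^ (N + 2)) q n * qpoch (1 / q ^ N) q n * qpoch (1 / (d * q ^ N)) q n)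
     / (qpoch (t * g * q * q) q (n + n) * qpoch (t * g * q * q ^ n) q n)"

context racah_parameters
begin

lemma racah_poly_eq_U:
  "racah_poly q g d t N n s = qpoch (1 / q ^ N) q n * qpoch A q n * qpoch H q n / qpoch (D * q ^ n) q n
     * poly (U n) (qlat q C s)"
  unfolding racah_poly_def U_def poly_sum poly_smult poly_phi[OF nonzero(1)] U_coeff_def ..

lemma racah_poly_orthogonality:
  assumes "n \<le> N" "m \<le> N"
  shows "(\<Sum>s=0..N. racah_poly q g d t N n s * racah_poly q g d t N m s * racah_wt q g d t N s)
     = (if n = m then racah_norm q g d t N n else 0)"
proof -
  let ?P = "\<lambda>n. qpoch (1 / q ^ N) q n * qpoch A q n * qpoch H q n / qpoch (D * q ^ n) q n"
  have "(\<Sum>s=0..N. racah_poly q g d t N n s * racah_poly q g d t N m s * racah_wt q g d t N s)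
      = ?P n * ?P m * (\<Sum>s=0..N. poly (U n) (qlat q C s) * poly (U m) (qlat q C s) * racah_wt q g d t N s)"
    unfolding racah_poly_eq_U sum_distrib_left by (intro sum.cong refl) (simp only: mult_ac)
  also have "\<dots> = (if n = m then ?P n * ?P n * U_norm n else 0)"
    unfolding racah_wt_orthogonality[OF assms] by simp
  also have "?P n * ?P n * U_norm n = racah_norm q g d t N n"
  proof -
    have "qpoch (D * q ^ n) q n \<noteq> 0" "qpoch H q n \<noteq> 0"
      using D_ne[of "n + _"] H_ne by (simp_all add: qpoch_nonzero power_add mult.assoc)
    moreover note qN_ne[OF assms(1)] A_ne[OF assms(1)]
    moreover have "(a * b * h / e) * (a * b * h / e) * (G * (x * e * y * z * w) / (a * b * h * r))
        = G * (x * z * b * y * h * a * w) / (r * e)"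
      if "e \<noteq> 0" "h \<noteq> 0" "a \<noteq> 0" "b \<noteq> 0" for a b h e G x y z w r :: real
      using that by (simp add: mult_ac)
    ultimately show ?thesis unfolding U_norm_def racah_norm_def by blast
  qed
  finally show ?thesis .
qed

end

section \<open>Identification with the objects of the statement\<close>

lemma Ccoef_qracah:
  assumes q: "0 < q" "q < 1" and b: "b = a + real N + 1" and g: "q powr \<beta> = g" and gd: "q powr (2 * a) = g * d"
  shows "Ccoef q g d n * qracah q \<alpha> \<beta> a b n (real s + a) = racah_poly q g d (q powr \<alpha>) N n s"
proof -
  have p: "q powr (real m) = q ^ m" for m using q by (simp add: powr_realpow)
  have pm: "q powr (- real m) = 1 / q ^ m" for m by (simp add: powr_minus_divide p)
  \<comment> \<open>The root (\<gamma>\<delta>q)^(n/2) is q^(n(2a+1)/2), the inverse of the power in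
    front of the polynomial; the remaining kappa^(2n) serves against the denominator.\<close>
  have C: "Ccoef q g d n * q powr (- (real n / 2) * (2 * a + 1)) = kappa q ^ (2 * n)"
  proof -
    have "g * d * q = q powr (2 * a + 1)" using q by (simp add: powr_add gd)
    then have "(g * d * q) powr (real n / 2) * q powr (- (real n / 2) * (2 * a + 1)) = 1"
      using q by (simp add: powr_powr flip: powr_add)
    then show ?thesis by (simp add: Ccoef_def mult_ac)
  qed
  have e: "q powr (a - b + 1) = 1 / q ^ N" "q powr (\<beta> + 1) = g * q"
    "q powr (a + b + \<alpha> + 1) = q powr \<alpha> * g * d * q ^ (N + 2)"
    "q powr (\<alpha> + \<beta> + real n + 1) = q powr \<alpha> * g * q * q ^ n"
    "q powr (a - (real s + a)) = 1 / q ^ s" "q powr (a + (real s + a) + 1) = g * d * q * q ^ s"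
  proof -
    have args: "a - b + 1 = - real N" "a + b + \<alpha> + 1 = \<alpha> + 2 * a + real (N + 2)" "a - (real s + a) = - real s"
      "a + (real s + a) + 1 = 2 * a + 1 + real s" by (simp_all add: b)
    show "q powr (a - b + 1) = 1 / q ^ N" "q powr (a + b + \<alpha> + 1) = q powr \<alpha> * g * d * q ^ (N + 2)"
      "q powr (a - (real s + a)) = 1 / q ^ s" "q powr (a + (real s + a) + 1) = g * d * q * q ^ s"
      unfolding args pm powr_add p gd using q by (simp_all add: mult.assoc)
    show "q powr (\<beta> + 1) = g * q" "q powr (\<alpha> + \<beta> + real n + 1) = q powr \<alpha> * g * q * q ^ n"
      using q by (simp_all add: powr_add p g)
  qed
  have "Ccoef q g d n * qracah q \<alpha> \<beta> a b n (real s + a)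
    = (Ccoef q g d n * q powr (- (real n / 2) * (2 * a + 1))) * ((qpochs [1 / q ^ N, g * q, q powr \<alpha> * g * d * q ^ (N + 2)] q n
        / (kappa q ^ (2 * n) * qpoch (q powr \<alpha> * g * q * q ^ n) q n))
     * qhyp [1 / q ^ n, q powr \<alpha> * g * q * q ^ n, 1 / q ^ s, g * d * q * q ^ s]
            [1 / q ^ N, g * q, q powr \<alpha> * g * d * q ^ (N + 2)] q q)"
    unfolding qracah_def e pm by (simp only: mult.assoc)
  also have "\<dots> = qpochs [1 / q ^ N, g * q, q powr \<alpha> * g * d * q ^ (N + 2)] q n / qpoch (q powr \<alpha> * g * q * q ^ n) q n
     * qhyp [1 / q ^ n, q powr \<alpha> * g * q * q ^ n, 1 / q ^ s, g * d * q * q ^ s]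
            [1 / q ^ N, g * q, q powr \<alpha> * g * d * q ^ (N + 2)] q q"
    unfolding C using kappa_nonzero[OF q] by simp
  also have "\<dots> = racah_poly q g d (q powr \<alpha>) N n s"
    using q unfolding racah_poly_def qhyp_terminating[OF less_imp_neq[OF q(1), symmetric]]
    by (simp add: qpochs_def mult_ac)
  finally show ?thesis .
qed

lemma Ccoef_nonzero:
  assumes "0 < q" "q < 1" "0 < g" "0 < d"
  shows "Ccoef q g d n \<noteq> 0"
  using assms kappa_nonzero[OF assms(1,2)] by (simp add: Ccoef_def)

lemma Ccoef_qracah_norm2:
  assumes q: "0 < q" "q < 1" and b: "b = a + real N + 1" and g: "q powr \<beta> = g" and gd: "q powr (2 * a) = g * d"
  shows "(Ccoef q g d n)\<^sup>2 * qracah_norm2 q \<alpha> \<beta> a b n = racah_norm q g d (q powr \<alpha>) N n"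
proof -
  have p: "q powr (real m) = q ^ m" for m using q by (simp add: powr_realpow)
  have gpos: "g \<noteq> 0" using g q by (auto simp flip: g)
  have e: "q powr (a - b + 1) = 1 / q ^ N" "q powr (\<beta> + 1) = g * q" "q powr (\<alpha> + 1) = q powr \<alpha> * q"
    "q powr (a + b + \<alpha> + 1) = q powr \<alpha> * g * d * q ^ (N + 2)"
    "q powr (\<alpha> + \<beta> + real n + 1) = q powr \<alpha> * g * q * q ^ n" "q powr (\<alpha> + \<beta> + 2) = q powr \<alpha> * g * q * q"
    "q powr (b - a + \<alpha> + \<beta> + 1) = q powr \<alpha> * g * q * q * q ^ N" "q powr (\<beta> - a - b + 1) = 1 / (d * q ^ N)"
  proof -
    have args: "a - b + 1 = - real N" "a + b + \<alpha> + 1 = \<alpha> + 2 * a + real (N + 2)"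
      "b - a + \<alpha> + \<beta> + 1 = \<alpha> + \<beta> + 1 + 1 + real N" "\<beta> - a - b + 1 = \<beta> - 2 * a - real N"
      "\<alpha> + \<beta> + 2 = \<alpha> + \<beta> + 1 + 1" by (simp_all add: b)
    show "q powr (a - b + 1) = 1 / q ^ N" "q powr (a + b + \<alpha> + 1) = q powr \<alpha> * g * d * q ^ (N + 2)"
      "q powr (b - a + \<alpha> + \<beta> + 1) = q powr \<alpha> * g * q * q * q ^ N"
      "q powr (\<beta> - a - b + 1) = 1 / (d * q ^ N)" "q powr (\<alpha> + \<beta> + 2) = q powr \<alpha> * g * q * q"
      unfolding args powr_add powr_diff powr_minus_divide p gd g using q gpos by (simp_all add: mult.assoc)
    show "q powr (\<beta> + 1) = g * q" "q powr (\<alpha> + \<beta> + real n + 1) = q powr \<alpha> * g * q * q ^ n"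
      "q powr (\<alpha> + 1) = q powr \<alpha> * q"
      using q by (simp_all add: powr_add p g)
  qed
  have k: "kappa q ^ (4 * n) \<noteq> 0" using kappa_nonzero[OF q] by simp
  have C: "(Ccoef q g d n)\<^sup>2 = (g * d * q) ^ n * kappa q ^ (4 * n)"
  proof -
    have pos: "0 < g * d * q" using q by (simp flip: gd)
    have "((g * d * q) powr (real n / 2))\<^sup>2 = (g * d * q) powr (real n / 2 + real n / 2)"
      by (simp only: power2_eq_square powr_add)
    also have "\<dots> = (g * d * q) ^ n" using pos by (simp add: powr_realpow)
    finally show ?thesis unfolding Ccoef_def power_mult_distrib power_mult[symmetric]
      by (simp add: mult.commute)
  qed
  show ?thesis unfolding qracah_norm2_def e C racah_norm_def mult_2
    using k by (simp add: qpochs_def mult_ac)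
qed

lemma dqh_eq_racah_poly:
  assumes "0 < q"
  shows "dqh q g d N n (real s) = racah_poly q g d 0 N n s"
proof -
  have e: "q powr (- real m) = 1 / q ^ m" "q powr (real m + 1) = q * q ^ m" for m
    using assms by (simp_all add: powr_minus_divide powr_realpow powr_add)
  show ?thesis
    using assms unfolding dqh_def racah_poly_def e qhyp_terminating[OF less_imp_neq[OF assms, symmetric]]
    by (simp add: qpochs_def mult_ac)
qed

lemma dqh_norm2_eq_racah_norm:
  assumes "0 < q"
  shows "dqh_norm2 q g d N n = racah_norm q g d 0 N n"
  using assms unfolding dqh_norm2_def racah_norm_def
  by (simp add: qpochs_def powr_minus_divide powr_realpow mult_ac inverse_eq_divide)

text \<open>Stated along \<open>nhds 0\<close> so that it composes directly with t = q^\<alpha>. The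
  denominators that survive at t = 0 are free of t.\<close>

lemma tendsto_racah_poly:
  assumes "0 < q" "q < 1" "n \<le> N" "\<And>i. i < N \<Longrightarrow> g * q * q ^ i \<noteq> 1"
  shows "((\<lambda>t. racah_poly q g d t N n s) \<longlongrightarrow> racah_poly q g d 0 N n s) (nhds 0)"
proof -
  have "qpoch (1 / q ^ N) q k * qpoch (g * q) q k * qpoch (0 * g * d * q ^ (N + 2)) q k * qpoch q q k \<noteq> 0"
    if "k \<in> {0..n}" for k
  proof -
    have "qpoch q q k \<noteq> 0" using assms(1,2) by (rule qpoch_self_nonzero)
    moreover have "qpoch (g * q) q k \<noteq> 0" using assms that by (intro qpoch_nonzero) auto
    moreover have "qpoch (1 / q ^ N) q k \<noteq> 0"
      using assms that by (intro qpoch_neg_power_nonzero) auto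
    ultimately show ?thesis by simp
  qed
  then show ?thesis unfolding racah_poly_def
    by (intro tendsto_intros tendsto_qpoch) (simp_all add: filterlim_ident)
qed

lemma tendsto_racah_norm: "((\<lambda>t. racah_norm q g d t N n) \<longlongrightarrow> racah_norm q g d 0 N n) (nhds 0)"
  unfolding racah_norm_def by (intro tendsto_intros tendsto_qpoch) (simp_all add: filterlim_ident)

lemma tendsto_racah_wt:
  assumes "0 < q" "q < 1" "\<And>i. i \<in> {0..N} - {s} \<Longrightarrow> g * d * q * q ^ (s + i) \<noteq> 1"
  shows "((\<lambda>t. racah_wt q g d t N s) \<longlongrightarrow> racah_wt q g d 0 N s) (nhds 0)"
proof -
  have "(\<Prod>i\<in>{0..N} - {s}. 1 - g * d * q * q ^ (s + i)) \<noteq> 0" using assms by auto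
  moreover have "qpoch (0 * g * q\<^sup>2) q N \<noteq> 0" by simp
  moreover have "qpoch q q k \<noteq> 0" for k using assms(1,2) by (rule qpoch_self_nonzero)
  ultimately show ?thesis unfolding racah_wt_def
    by (intro tendsto_intros tendsto_qpoch) (simp_all add: filterlim_ident del: prod_zero_iff)
qed

lemma powr_tendsto_0_at_top:
  fixes q :: real
  assumes "0 < q" "q < 1"
  shows "((\<lambda>x. q powr x) \<longlongrightarrow> 0) at_top"
proof -
  have "filterlim (\<lambda>x. ln q * x) at_bot at_top"
    using assms by (intro filterlim_tendsto_neg_mult_at_bot[OF tendsto_const _ filterlim_ident]) simp
  then have "((\<lambda>x. exp (ln q * x)) \<longlongrightarrow> 0) at_top" by (rule filterlim_compose[OF exp_at_bot])
  then show ?thesis using assms by (simp add: powr_def mult.commute)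
qed

text \<open>Removing c_3 and c_1 leaves q^(s+a) + q^(-s-a-1); multiplication by q^(a+1) and q^(2a) =
  \<gamma>\<delta> give the two terms of x(s).\<close>

lemma mu_tilde_eq_dqh_x:
  assumes q: "0 < q" "q < 1" and gd: "q powr (2 * a) = g * d"
  shows "mu_tilde q a s = dqh_x q g d s"
proof -
  let ?k = "(kappa q)\<^sup>2"
  have k: "?k \<noteq> 0" using kappa_nonzero[OF q] by simp
  define h where "h = q powr (1/2)"
  have h: "h > 0" using q by (simp add: h_def)
  have hq: "q = h * h" using q by (simp add: h_def flip: powr_add)
  define w where "w = q powr ((s + a) / 2)"
  have w: "w > 0" using q by (simp add: w_def)
  have w2: "q powr ((s + a + 1) / 2) = w * h" by (simp add: w_def h_def flip: powr_add) (simp add: field_simps)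
  have "lattice_mu q (s + a) = (w - 1 / w) * (w * h - 1 / (w * h)) / ?k"
    unfolding lattice_mu_def qnum_def kappa_def[symmetric]
    unfolding powr_minus_divide w2 w_def[symmetric]
    by (simp add: power2_eq_square)
  moreover have "lattice_c3 q = - (1 / h * (1 + h * h) / ?k)"
    unfolding lattice_c3_def powr_minus_divide h_def[symmetric] hq[symmetric] ..
  moreover have "lattice_c1 q = h / ?k" unfolding lattice_c1_def h_def ..
  moreover have "((w - 1 / w) * (w * h - 1 / (w * h)) / K - - (1 / h * (1 + h * h) / K)) / (h / K)
      = w * w + 1 / (w * w * (h * h))" if "K \<noteq> 0" for K :: real
    using that h w by (simp add: field_simps)
  ultimately have "mu_tilde q a s = q powr (a + 1) * (w * w + 1 / (w * w * (h * h)))"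
    unfolding mu_tilde_def using k by simp
  also have "w * w = q powr (s + a)" by (simp add: w_def flip: powr_add)
  also have "q powr (a + 1) * (q powr (s + a) + 1 / (q powr (s + a) * (h * h)))
      = q powr (2 * a) * q powr (s + 1) + q powr (- s)"
  proof -
    have "q powr (a + 1) * q powr (s + a) = q powr (2 * a) * q powr (s + 1)"
      unfolding powr_add[symmetric] by (rule arg_cong[of _ _ "\<lambda>x. q powr x"]) simp
    moreover have "q powr (a + 1) / (q powr (s + a) * q) = q powr (- s)"
      using q by (simp add: powr_add powr_minus_divide)
    ultimately show ?thesis by (simp add: distrib_left flip: hq)
  qed
  finally show ?thesis unfolding dqh_x_def gd by simp
qed

theorem theorem2:
  fixes q \<gamma> \<delta> a b \<beta> :: real and N :: nat
  assumes q: "0 < q" "q < 1"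
    and N: "1 \<le> N"
    and params: "(0 < \<gamma> * q \<and> \<gamma> * q < 1 \<and> 0 < \<delta> * q \<and> \<delta> * q < 1)
                \<or> (q powr (- real N) < \<gamma> \<and> q powr (- real N) < \<delta>)"
    and ab: "b - a = real N + 1"
    and beta: "q powr \<beta> = \<gamma>"
    and a: "q powr (2 * a) = \<gamma> * \<delta>"
  shows
   "(\<forall>s. mu_tilde q a s = dqh_x q \<gamma> \<delta> s)
    \<and>
    (\<forall>n\<le>N. \<forall>s\<le>N.
       ((\<lambda>\<alpha>. Ccoef q \<gamma> \<delta> n * qracah q \<alpha> \<beta> a b n (real s + a))
          \<longlongrightarrow> dqh q \<gamma> \<delta> N n (real s)) at_top)
    \<and>
    (\<forall>\<^sub>F \<alpha> in at_top. \<forall>n\<le>N. \<forall>m\<le>N.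
       (\<Sum>s=0..N. qracah q \<alpha> \<beta> a b n (real s + a) * qracah q \<alpha> \<beta> a b m (real s + a)
                    * qracah_weight q \<alpha> \<beta> a b (real s + a))
       = (if n = m then qracah_norm2 q \<alpha> \<beta> a b n else 0))
    \<and>
    (\<forall>n\<le>N. \<forall>m\<le>N.
       ((\<lambda>\<alpha>. Ccoef q \<gamma> \<delta> n * Ccoef q \<gamma> \<delta> m *
             (\<Sum>s=0..N. qracah q \<alpha> \<beta> a b n (real s + a) * qracah q \<alpha> \<beta> a b m (real s + a)
                          * qracah_weight q \<alpha> \<beta> a b (real s + a)))
          \<longlongrightarrow> (\<Sum>s=0..N. dqh q \<gamma> \<delta> N n (real s) * dqh q \<gamma> \<delta> N m (real s)
                          * dqh_weight q \<gamma> \<delta> N s)) at_top)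
    \<and> (\<forall>n\<le>N. \<forall>m\<le>N.
       ((\<lambda>\<alpha>. Ccoef q \<gamma> \<delta> n * Ccoef q \<gamma> \<delta> m * (if n = m then qracah_norm2 q \<alpha> \<beta> a b n else 0))
          \<longlongrightarrow> (if n = m then dqh_norm2 q \<gamma> \<delta> N n else 0)) at_top)
    \<and>
    (\<forall>s\<le>N. ((\<lambda>\<alpha>. qracah_weight q \<alpha> \<beta> a b (real s + a)) \<longlongrightarrow> dqh_weight q \<gamma> \<delta> N s) at_top)
    \<and> (\<forall>n\<le>N. ((\<lambda>\<alpha>. (Ccoef q \<gamma> \<delta> n)\<^sup>2 * qracah_norm2 q \<alpha> \<beta> a b n)
                 \<longlongrightarrow> dqh_norm2 q \<gamma> \<delta> N n) at_top)
    \<and>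
    (\<forall>n\<le>N. \<forall>m\<le>N.
       (\<Sum>s=0..N. dqh q \<gamma> \<delta> N n (real s) * dqh q \<gamma> \<delta> N m (real s) * dqh_weight q \<gamma> \<delta> N s)
       = (if n = m then dqh_norm2 q \<gamma> \<delta> N n else 0))"
proof -
  have b: "b = a + real N + 1" using ab by simp
  have qN: "q powr (- real N) = 1 / q ^ N" using q by (simp add: powr_minus_divide powr_realpow)
  have pos: "0 < \<gamma>" "0 < \<delta>"
    using params q unfolding qN
    by (auto simp: zero_less_mult_iff dest: order_less_trans[of 0, rotated])
  \<comment> \<open>In the second range i + 1 \<le> N puts the product above 1, in the first it
    stays below 1.\<close>
  have ne1: "x * q * q ^ i \<noteq> 1" if "i < N" "0 < x * q \<and> x * q < 1 \<or> 1 / q ^ N < x" for x i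
    using that(2)
  proof
    assume x: "0 < x * q \<and> x * q < 1"
    have "x * q * q ^ i \<le> x * q * 1" using q x by (intro mult_left_mono power_le_one) auto
    then show ?thesis using x by simp
  next
    assume x: "1 / q ^ N < x"
    have "0 < 1 / q ^ N" using q by simp
    then have "0 < x" using x by linarith
    have "1 < x * q ^ N" using x q by (simp add: field_simps)
    also have "\<dots> \<le> x * q ^ Suc i" using q \<open>0 < x\<close> that by (intro mult_left_mono power_decreasing) auto
    finally show ?thesis by simp
  qed
  have gne: "\<gamma> * q * q ^ i \<noteq> 1" and dne: "\<delta> * q * q ^ i \<noteq> 1" if "i < N" for i
    using ne1[OF that] params unfolding qN by blast+
  \<comment> \<open>The strict inequality i < j is decisive. In the first range i + j \<ge> 1
    supplies the second q for (\<gamma>q)(\<delta>q) < 1; in the second i + j + 1 \<le> 2N allows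
    comparison with (\<gamma>q^N)(\<delta>q^N) > 1. For i = j the product can be 1: at i = 0 in the
    first range, at i = N in the second.\<close>
  have gdne: "\<gamma> * \<delta> * q * q ^ (i + j) \<noteq> 1" if "i < j" "j \<le> N" for i j
    using params unfolding qN
  proof
    assume x: "0 < \<gamma> * q \<and> \<gamma> * q < 1 \<and> 0 < \<delta> * q \<and> \<delta> * q < 1"
    obtain k where k: "i + j = Suc k" using \<open>i < j\<close> by (cases "i + j") auto
    have "\<gamma> * \<delta> * q * q ^ (i + j) = (\<gamma> * q) * (\<delta> * q) * q ^ k" by (simp add: k mult_ac)
    also have "\<dots> \<le> (\<gamma> * q) * (\<delta> * q)" using x q by (intro mult_right_le_one_le power_le_one) auto
    also have "(\<gamma> * q) * (\<delta> * q) < 1 * 1" using x by (intro mult_strict_mono) auto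
    finally show ?thesis by simp
  next
    assume x: "1 / q ^ N < \<gamma> \<and> 1 / q ^ N < \<delta>"
    then have "1 < \<gamma> * q ^ N" "1 < \<delta> * q ^ N" using q by (simp_all add: field_simps)
    then have "1 * 1 < (\<gamma> * q ^ N) * (\<delta> * q ^ N)" by (intro mult_strict_mono) auto
    also have "\<dots> = \<gamma> * \<delta> * q ^ (N + N)" by (simp add: power_add)
    also have "\<dots> \<le> \<gamma> * \<delta> * q ^ Suc (i + j)"
      using q pos that by (intro mult_left_mono power_decreasing) auto
    finally show ?thesis by (simp add: mult.assoc)
  qed
  have gdne': "\<gamma> * \<delta> * q * q ^ (s + i) \<noteq> 1" if "s \<le> N" "i \<in> {0..N} - {s}" for s i
    using gdne[of s i] gdne[of i s] that by (cases "s < i") (auto simp: add.commute)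
  have d: "q powr (2 * a - \<beta>) = \<delta>" using pos by (simp add: powr_diff a beta)
  have t0: "((\<lambda>\<alpha>. q powr \<alpha>) \<longlongrightarrow> 0) at_top" using q by (rule powr_tendsto_0_at_top)

  have C: "Ccoef q \<gamma> \<delta> n * qracah q \<alpha> \<beta> a b n (real s + a) = racah_poly q \<gamma> \<delta> (q powr \<alpha>) N n s" for n s \<alpha>
    by (rule Ccoef_qracah[OF q b beta a])
  have C2: "(Ccoef q \<gamma> \<delta> n)\<^sup>2 * qracah_norm2 q \<alpha> \<beta> a b n = racah_norm q \<gamma> \<delta> (q powr \<alpha>) N n" for n \<alpha>
    by (rule Ccoef_qracah_norm2[OF q b beta a])
  have Cn: "Ccoef q \<gamma> \<delta> n \<noteq> 0" for n by (rule Ccoef_nonzero[OF q pos])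
  have dw: "dqh_weight q \<gamma> \<delta> N s = racah_wt q \<gamma> \<delta> 0 N s" if "s \<le> N" for s
    using gdne'[OF that] dne by (intro dqh_weight_eq[OF q that pos])

  \<comment> \<open>The three bounds are the positivity conditions on \<alpha> + 1, \<alpha> +
    \<beta> + 2 and 2a + N + 2 + \<alpha> of \<open>qracah_weight_eq\<close>.\<close>
  have weight: "eventually (\<lambda>\<alpha>. \<forall>s\<le>N. qracah_weight q \<alpha> \<beta> a b (real s + a)
      = racah_wt q \<gamma> \<delta> (q powr \<alpha>) N s) at_top"
    using eventually_gt_at_top[of "-1"] eventually_gt_at_top[of "- \<beta> - 2"]
      eventually_gt_at_top[of "- 2 * a - real N - 2"]
  proof eventually_elim
    case (elim \<alpha>)
    show ?case
    proof (intro allI impI)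
      fix s assume s: "s \<le> N"
      show "qracah_weight q \<alpha> \<beta> a b (real s + a) = racah_wt q \<gamma> \<delta> (q powr \<alpha>) N s"
        using qracah_weight_eq[OF q b s, of \<alpha> \<beta>] elim gdne'[OF s] by (simp add: a beta d)
    qed
  qed
  have small: "eventually (\<lambda>\<alpha>. q powr \<alpha> * x < 1) at_top" for x
    using order_tendstoD(2)[OF tendsto_mult_left_zero[OF t0, of x], of 1] by simp
  have orth: "eventually (\<lambda>\<alpha>. \<forall>n\<le>N. \<forall>m\<le>N.
      (\<Sum>s=0..N. racah_poly q \<gamma> \<delta> (q powr \<alpha>) N n s * racah_poly q \<gamma> \<delta> (q powr \<alpha>) N m s
          * qracah_weight q \<alpha> \<beta> a b (real s + a))
       = (if n = m then racah_norm q \<gamma> \<delta> (q powr \<alpha>) N n else 0)) at_top"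
    using weight small[of 1] small[of \<gamma>] small[of "\<gamma> * \<delta>"]
  proof eventually_elim
    case (elim \<alpha>)
    interpret racah_parameters q \<gamma> \<delta> "q powr \<alpha>" N
      using q pos elim gne dne gdne by unfold_locales (simp_all add: mult.assoc)
    show ?case
    proof (intro allI impI)
      fix n m assume nm: "n \<le> N" "m \<le> N"
      show "(\<Sum>s=0..N. racah_poly q \<gamma> \<delta> (q powr \<alpha>) N n s * racah_poly q \<gamma> \<delta> (q powr \<alpha>) N m s
          * qracah_weight q \<alpha> \<beta> a b (real s + a))
       = (if n = m then racah_norm q \<gamma> \<delta> (q powr \<alpha>) N n else 0)"
        unfolding racah_poly_orthogonality[OF nm, symmetric]
        using elim(1) by (intro sum.cong) simp_all
    qed
  qed
  have scaled: "Ccoef q \<gamma> \<delta> n * Ccoef q \<gamma> \<delta> m *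
       (\<Sum>s=0..N. qracah q \<alpha> \<beta> a b n (real s + a) * qracah q \<alpha> \<beta> a b m (real s + a)
          * qracah_weight q \<alpha> \<beta> a b (real s + a))
     = (\<Sum>s=0..N. racah_poly q \<gamma> \<delta> (q powr \<alpha>) N n s * racah_poly q \<gamma> \<delta> (q powr \<alpha>) N m s
          * qracah_weight q \<alpha> \<beta> a b (real s + a))" for n m \<alpha>
    unfolding C[symmetric] sum_distrib_left by (intro sum.cong refl) (simp only: mult_ac)

  have c2: "((\<lambda>\<alpha>. Ccoef q \<gamma> \<delta> n * qracah q \<alpha> \<beta> a b n (real s + a)) \<longlongrightarrow> dqh q \<gamma> \<delta> N n (real s)) at_top"
    if "n \<le> N" for n s
    unfolding C dqh_eq_racah_poly[OF q(1)]
    by (rule filterlim_compose[OF tendsto_racah_poly[OF q that gne] t0])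
  have c6: "((\<lambda>\<alpha>. qracah_weight q \<alpha> \<beta> a b (real s + a)) \<longlongrightarrow> dqh_weight q \<gamma> \<delta> N s) at_top"
    if "s \<le> N" for s
  proof -
    have "((\<lambda>\<alpha>. racah_wt q \<gamma> \<delta> (q powr \<alpha>) N s) \<longlongrightarrow> racah_wt q \<gamma> \<delta> 0 N s) at_top"
      by (rule filterlim_compose[OF tendsto_racah_wt[OF q gdne'[OF that]] t0])
    moreover have "eventually (\<lambda>\<alpha>. racah_wt q \<gamma> \<delta> (q powr \<alpha>) N s = qracah_weight q \<alpha> \<beta> a b (real s + a)) at_top"
      using weight by eventually_elim (use that in simp)
    ultimately show ?thesis unfolding dw[OF that] using tendsto_cong by fast
  qed
  have c7: "((\<lambda>\<alpha>. (Ccoef q \<gamma> \<delta> n)\<^sup>2 * qracah_norm2 q \<alpha> \<beta> a b n) \<longlongrightarrow> dqh_norm2 q \<gamma> \<delta> N n) at_top" for n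
    unfolding C2 dqh_norm2_eq_racah_norm[OF q(1)] by (rule filterlim_compose[OF tendsto_racah_norm t0])
  have c3: "\<forall>\<^sub>F \<alpha> in at_top. \<forall>n\<le>N. \<forall>m\<le>N.
       (\<Sum>s=0..N. qracah q \<alpha> \<beta> a b n (real s + a) * qracah q \<alpha> \<beta> a b m (real s + a)
                    * qracah_weight q \<alpha> \<beta> a b (real s + a))
       = (if n = m then qracah_norm2 q \<alpha> \<beta> a b n else 0)"
    using orth
  proof eventually_elim
    case (elim \<alpha>)
    show ?case
    proof (intro allI impI)
      fix n m assume nm: "n \<le> N" "m \<le> N"
      have "Ccoef q \<gamma> \<delta> n * Ccoef q \<gamma> \<delta> m *
         (\<Sum>s=0..N. qracah q \<alpha> \<beta> a b n (real s + a) * qracah q \<alpha> \<beta> a b m (real s + a)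
            * qracah_weight q \<alpha> \<beta> a b (real s + a))
         = Ccoef q \<gamma> \<delta> n * Ccoef q \<gamma> \<delta> m * (if n = m then qracah_norm2 q \<alpha> \<beta> a b n else 0)"
        unfolding scaled using elim nm C2[of n \<alpha>] by (auto simp: power2_eq_square)
      moreover have "Ccoef q \<gamma> \<delta> n * Ccoef q \<gamma> \<delta> m \<noteq> 0" using Cn by simp
      ultimately show "(\<Sum>s=0..N. qracah q \<alpha> \<beta> a b n (real s + a) * qracah q \<alpha> \<beta> a b m (real s + a)
                    * qracah_weight q \<alpha> \<beta> a b (real s + a))
         = (if n = m then qracah_norm2 q \<alpha> \<beta> a b n else 0)"
        using mult_left_cancel by blast
    qed
  qed
  have c4: "((\<lambda>\<alpha>. Ccoef q \<gamma> \<delta> n * Ccoef q \<gamma> \<delta> m *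
             (\<Sum>s=0..N. qracah q \<alpha> \<beta> a b n (real s + a) * qracah q \<alpha> \<beta> a b m (real s + a)
                          * qracah_weight q \<alpha> \<beta> a b (real s + a)))
          \<longlongrightarrow> (\<Sum>s=0..N. dqh q \<gamma> \<delta> N n (real s) * dqh q \<gamma> \<delta> N m (real s)
                          * dqh_weight q \<gamma> \<delta> N s)) at_top" if "n \<le> N" "m \<le> N" for n m
    unfolding scaled using c2[OF that(1)] c2[OF that(2)] c6 unfolding C
    by (intro tendsto_sum tendsto_mult) auto
  have c5: "((\<lambda>\<alpha>. Ccoef q \<gamma> \<delta> n * Ccoef q \<gamma> \<delta> m * (if n = m then qracah_norm2 q \<alpha> \<beta> a b n else 0))
          \<longlongrightarrow> (if n = m then dqh_norm2 q \<gamma> \<delta> N n else 0)) at_top" for n m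
    using c7[of n] by (cases "n = m") (simp_all add: power2_eq_square)
  have c8: "(\<Sum>s=0..N. dqh q \<gamma> \<delta> N n (real s) * dqh q \<gamma> \<delta> N m (real s) * dqh_weight q \<gamma> \<delta> N s)
       = (if n = m then dqh_norm2 q \<gamma> \<delta> N n else 0)" if nm: "n \<le> N" "m \<le> N" for n m
  proof (rule tendsto_unique[OF _ c4[OF nm]])
    have "eventually (\<lambda>\<alpha>. Ccoef q \<gamma> \<delta> n * Ccoef q \<gamma> \<delta> m * (if n = m then qracah_norm2 q \<alpha> \<beta> a b n else 0)
       = Ccoef q \<gamma> \<delta> n * Ccoef q \<gamma> \<delta> m *
             (\<Sum>s=0..N. qracah q \<alpha> \<beta> a b n (real s + a) * qracah q \<alpha> \<beta> a b m (real s + a)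
                          * qracah_weight q \<alpha> \<beta> a b (real s + a))) at_top"
      using c3 by eventually_elim (use nm in simp)
    then show "((\<lambda>\<alpha>. Ccoef q \<gamma> \<delta> n * Ccoef q \<gamma> \<delta> m *
             (\<Sum>s=0..N. qracah q \<alpha> \<beta> a b n (real s + a) * qracah q \<alpha> \<beta> a b m (real s + a)
                          * qracah_weight q \<alpha> \<beta> a b (real s + a)))
        \<longlongrightarrow> (if n = m then dqh_norm2 q \<gamma> \<delta> N n else 0)) at_top"
      using c5[of n m] by (rule Lim_transform_eventually[rotated])
  qed simp
  show ?thesis
    using mu_tilde_eq_dqh_x[OF q a] c2 c3 c4 c5 c6 c7 c8 by blast
qed

end
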